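(* The theory $\mathcal{M}^*(PI)$ is categorical; that is, it is consistent (it has a model) and any two of its models are isomorphic.
   Context: Reasoning takes place in ordinary set theory (ZFC); models are taken in the full set-theoretic sense (axioms may quantify over sets of sounds and over real-valued functions). A model of $\mathcal{M}^*(PI)$ consists of a set $\mathbb{S}$ (of "sounds"), a binary relation $*$ on $\mathbb{S}$ ("lower-pitched") and a binary relation $\cong$ ("congruence") on intervals, satisfying the axioms below. Pitch. Write $x\sim y$ iff neither $x*y$ nor $y*x$. (1) $\neg(x*x)$ for all $x$. (2) $*$ is transitive. (3) There are $x,y$ with $x*y$ or $y*x$. (4) If $x*y$, then no $z$ satisfies both $x\sim z$ and $y\sim z$. (5) For every $x$ there are $a,b$ with $a*x$ and $x*b$; and if $x*y$ there is $a$ with $x*a$ and $a*y$. Then $\sim$ is an equivalence relation; $\tilde{x}$ is the class of $x$. Intervals. $[a,b]:=(\tilde a,\tilde b)$, $[a,b]^{-1}:=[b,a]$, $\mathbb{I}:=(\mathbb{S}/\sim)\times(\mathbb{S}/\sim)$, and $\cong$ is a binary relation on $\mathbb{I}$. (6) $\cong$ is reflexive. (7) $\cong$ is transitive. (8) For all $x,y,a$ there is $b$ with $[x,y]\cong[a,b]$, and any $b'$ with $[x,y]\cong[a,b']$ satisfies $b\sim b'$. (9) If $a*b$: $[a,b]\cong[c,d]$ implies $c*d$; and $[a,b]\cong[c,d]$ iff $[b,a]\cong[d,c]$. (10) If $a*b$ and $b*c$: $[a,b]\cong[a',b']$ and $[b,c]\cong[b',c']$ imply $[a,c]\cong[a',c']$;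 and $[a,b]\cong[a',b']^{-1}$ and $[b,c]\cong[b',c']^{-1}$ imply $[a,c]\cong[a',c']^{-1}$. (11) (Dedekind) If $\mathbb{S}$ is partitioned into two nonempty sets $P,Q$ such that no sound of $Q$ is lower-pitched than a sound of $P$, there is $\theta\in\mathbb{S}$ such that every $s*\theta$ lies in $P$ and every $s$ with $\theta*s$ lies in $Q$. Measure and frequency. Sounds $x_0,y_0$ with $x_0*y_0$ and real numbers $\lambda>1$, $f_0>0$, $\iota_0>0$ are given once and for all. Under (1)-(11) there is a unique function $|\cdot|:\mathbb{I}\to\mathbb{R}^+$ with $|[x_0,y_0]|=\lambda$, $|[a,b]|>1$ iff $a*b$, $|[a,b]|=1$ iff $a\sim b$, $|[a,b]|<1$ iff $b*a$, $|[a,b]|=|[c,d]|$ iff $[a,b]\cong[c,d]$, $|[a,c]|=|[a,b]|\cdot|[b,c]|$; it is onto. The frequency of sounds is $f:\mathbb{S}\to\mathbb{R}^+$, $f(x)=f_0\cdot|[x_0,x]|$. Loudness and colour. Let $C_p(\mathbb{R})$ be the set of nonconstant periodic continuous functions $\mathbb{R}\to\mathbb{R}$; for $g\in C_p(\mathbb{R})$ let $T_g$ be its least positive period and $A_g=\max g-\min g$ the diameter of its range. (12) There is a function $\iota:\mathbb{S}\to\mathbb{R}^+$ (intensity) with $\iota(x_0)=\iota_0$ such that for every $r\in\mathbb{R}^+$ and $s\in\mathbb{S}$ there is $x\sim s$ with $\iota(x)=r$. (13') There is a function $\Gamma:\mathbb{S}\to C_p(\mathbb{R})$ (timbre) with $T_{\Gamma(x)}=f(x)$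 and $A_{\Gamma(x)}=\iota(x)$ for all $x$, and $\Gamma$ is onto $C_p(\mathbb{R})$. (14) $\Gamma(x)=\Gamma(y)$ implies $x=y$. An isomorphism between two models $\mathcal{M}_1,\mathcal{M}_2$ is a bijection $h:\mathbb{S}_1\to\mathbb{S}_2$ preserving the undefined concepts in both directions: $x*_1y\Leftrightarrow h(x)*_2h(y)$ and $[a,b]\cong_1[c,d]\Leftrightarrow[h(a),h(b)]\cong_2[h(c),h(d)]$. *)

theory Defs
  imports "HOL-Analysis.Analysis"
begin

definition same_pitch :: "'a set \<Rightarrow> ('a \<times> 'a) set \<Rightarrow> ('a \<times> 'a) set" where
  "same_pitch S lower = {(x, y). x \<in> S \<and> y \<in> S \<and> (x, y) \<notin> lower \<and> (y, x) \<notin> lower}"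

definition pitch_class :: "'a set \<Rightarrow> ('a \<times> 'a) set \<Rightarrow> 'a \<Rightarrow> 'a set" where
  "pitch_class S lower x = same_pitch S lower `` {x}"

definition interval :: "'a set \<Rightarrow> ('a \<times> 'a) set \<Rightarrow> 'a \<Rightarrow> 'a \<Rightarrow> 'a set \<times> 'a set" where
  "interval S lower a b = (pitch_class S lower a, pitch_class S lower b)"

definition intervals :: "'a set \<Rightarrow> ('a \<times> 'a) set \<Rightarrow> ('a set \<times> 'a set) set" where
  "intervals S lower = (S // same_pitch S lower) \<times> (S // same_pitch S lower)"

locale pitch_space =
  fixes S :: "'a set" and lower :: "('a \<times> 'a) set"
  assumes lower_on: "lower \<subseteq> S \<times> S"
    and lower_irrefl: "\<forall>x\<in>S. (x, x) \<notin> lower"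
    and lower_trans: "trans lower"
    and lower_nontrivial: "\<exists>x\<in>S. \<exists>y\<in>S. (x, y) \<in> lower \<or> (y, x) \<in> lower"
    and lower_separates: "\<forall>x\<in>S. \<forall>y\<in>S. (x, y) \<in> lower \<longrightarrow>
          \<not> (\<exists>z\<in>S. (x, z) \<in> same_pitch S lower \<and> (y, z) \<in> same_pitch S lower)"
    and lower_unbounded: "\<forall>x\<in>S. \<exists>a\<in>S. \<exists>b\<in>S. (a, x) \<in> lower \<and> (x, b) \<in> lower"
    and lower_dense: "\<forall>x\<in>S. \<forall>y\<in>S. (x, y) \<in> lower \<longrightarrow>
          (\<exists>a\<in>S. (x, a) \<in> lower \<and> (a, y) \<in> lower)"

locale interval_space = pitch_space S lower
  for S :: "'a set" and lower :: "('a \<times> 'a) set" +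
  fixes congr :: "(('a set \<times> 'a set) \<times> ('a set \<times> 'a set)) set"
  assumes congr_on: "congr \<subseteq> intervals S lower \<times> intervals S lower"
    and congr_refl: "\<forall>i\<in>intervals S lower. (i, i) \<in> congr"
    and congr_trans: "trans congr"
    and congr_transport: "\<forall>x\<in>S. \<forall>y\<in>S. \<forall>a\<in>S. \<exists>b\<in>S.
          (interval S lower x y, interval S lower a b) \<in> congr \<and>
          (\<forall>b'\<in>S. (interval S lower x y, interval S lower a b') \<in> congr
             \<longrightarrow> (b, b') \<in> same_pitch S lower)"
    and congr_lower: "\<forall>a\<in>S. \<forall>b\<in>S. \<forall>c\<in>S. \<forall>d\<in>S. (a, b) \<in> lower \<longrightarrow>
          (interval S lower a b, interval S lower c d) \<in> congr \<longrightarrow> (c, d) \<in> lower"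
    and congr_inverse: "\<forall>a\<in>S. \<forall>b\<in>S. \<forall>c\<in>S. \<forall>d\<in>S. (a, b) \<in> lower \<longrightarrow>
          ((interval S lower a b, interval S lower c d) \<in> congr \<longleftrightarrow>
           (interval S lower b a, interval S lower d c) \<in> congr)"
    and congr_compose: "\<forall>a\<in>S. \<forall>b\<in>S. \<forall>c\<in>S. \<forall>a'\<in>S. \<forall>b'\<in>S. \<forall>c'\<in>S.
          (a, b) \<in> lower \<longrightarrow> (b, c) \<in> lower \<longrightarrow>
          (interval S lower a b, interval S lower a' b') \<in> congr \<longrightarrow>
          (interval S lower b c, interval S lower b' c') \<in> congr \<longrightarrow>
          (interval S lower a c, interval S lower a' c') \<in> congr"
    and congr_compose_inverse: "\<forall>a\<in>S. \<forall>b\<in>S. \<forall>c\<in>S. \<forall>a'\<in>S. \<forall>b'\<in>S. \<forall>c'\<in>S.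
          (a, b) \<in> lower \<longrightarrow> (b, c) \<in> lower \<longrightarrow>
          (interval S lower a b, interval S lower b' a') \<in> congr \<longrightarrow>
          (interval S lower b c, interval S lower c' b') \<in> congr \<longrightarrow>
          (interval S lower a c, interval S lower c' a') \<in> congr"
    and dedekind: "\<forall>P Q. P \<union> Q = S \<longrightarrow> P \<inter> Q = {} \<longrightarrow> P \<noteq> {} \<longrightarrow> Q \<noteq> {} \<longrightarrow>
          (\<forall>q\<in>Q. \<forall>p\<in>P. (q, p) \<notin> lower) \<longrightarrow>
          (\<exists>\<theta>\<in>S. (\<forall>s\<in>S. (s, \<theta>) \<in> lower \<longrightarrow> s \<in> P) \<and>
                 (\<forall>s\<in>S. (\<theta>, s) \<in> lower \<longrightarrow> s \<in> Q))"

text \<open>A measure is required to be extensional on the set of intervals, so that it is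
  determined as a HOL function by its values there.\<close>

definition is_measure ::
  "'a set \<Rightarrow> ('a \<times> 'a) set \<Rightarrow> (('a set \<times> 'a set) \<times> ('a set \<times> 'a set)) set \<Rightarrow>
   'a \<Rightarrow> 'a \<Rightarrow> real \<Rightarrow> ('a set \<times> 'a set \<Rightarrow> real) \<Rightarrow> bool" where
  "is_measure S lower congr x0 y0 lam m \<longleftrightarrow>
     m \<in> intervals S lower \<rightarrow>\<^sub>E {0<..} \<and>
     m (interval S lower x0 y0) = lam \<and>
     (\<forall>a\<in>S. \<forall>b\<in>S.
        (m (interval S lower a b) > 1 \<longleftrightarrow> (a, b) \<in> lower) \<and>
        (m (interval S lower a b) = 1 \<longleftrightarrow> (a, b) \<in> same_pitch S lower) \<and>
        (m (interval S lower a b) < 1 \<longleftrightarrow> (b, a) \<in> lower)) \<and>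
     (\<forall>a\<in>S. \<forall>b\<in>S. \<forall>c\<in>S. \<forall>d\<in>S.
        m (interval S lower a b) = m (interval S lower c d) \<longleftrightarrow>
        (interval S lower a b, interval S lower c d) \<in> congr) \<and>
     (\<forall>a\<in>S. \<forall>b\<in>S. \<forall>c\<in>S.
        m (interval S lower a c) = m (interval S lower a b) * m (interval S lower b c))"

definition interval_measure ::
  "'a set \<Rightarrow> ('a \<times> 'a) set \<Rightarrow> (('a set \<times> 'a set) \<times> ('a set \<times> 'a set)) set \<Rightarrow>
   'a \<Rightarrow> 'a \<Rightarrow> real \<Rightarrow> 'a set \<times> 'a set \<Rightarrow> real" where
  "interval_measure S lower congr x0 y0 lam = (THE m. is_measure S lower congr x0 y0 lam m)"

definition frequency ::
  "'a set \<Rightarrow> ('a \<times> 'a) set \<Rightarrow> (('a set \<times> 'a set) \<times> ('a set \<times> 'a set)) set \<Rightarrow>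
   'a \<Rightarrow> 'a \<Rightarrow> real \<Rightarrow> real \<Rightarrow> 'a \<Rightarrow> real" where
  "frequency S lower congr x0 y0 lam f0 x =
     f0 * interval_measure S lower congr x0 y0 lam (interval S lower x0 x)"

definition Cp :: "(real \<Rightarrow> real) set" where
  "Cp = {g. continuous_on UNIV g \<and> \<not> g constant_on UNIV \<and> (\<exists>T>0. \<forall>t. g (t + T) = g t)}"

definition least_period :: "(real \<Rightarrow> real) \<Rightarrow> real" where
  "least_period g = (LEAST T. 0 < T \<and> (\<forall>t. g (t + T) = g t))"

definition amplitude :: "(real \<Rightarrow> real) \<Rightarrow> real" where
  "amplitude g = (GREATEST r. r \<in> range g) - (LEAST r. r \<in> range g)"

definition is_intensity ::
  "'a set \<Rightarrow> ('a \<times> 'a) set \<Rightarrow> 'a \<Rightarrow> real \<Rightarrow> ('a \<Rightarrow> real) \<Rightarrow> bool" where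
  "is_intensity S lower x0 i0 \<iota> \<longleftrightarrow>
     \<iota> \<in> S \<rightarrow> {0<..} \<and> \<iota> x0 = i0 \<and>
     (\<forall>r>0. \<forall>s\<in>S. \<exists>x\<in>S. (x, s) \<in> same_pitch S lower \<and> \<iota> x = r)"

definition is_timbre ::
  "'a set \<Rightarrow> ('a \<Rightarrow> real) \<Rightarrow> ('a \<Rightarrow> real) \<Rightarrow> ('a \<Rightarrow> real \<Rightarrow> real) \<Rightarrow> bool" where
  "is_timbre S f \<iota> \<Gamma> \<longleftrightarrow>
     \<Gamma> \<in> S \<rightarrow> Cp \<and>
     (\<forall>x\<in>S. least_period (\<Gamma> x) = f x \<and> amplitude (\<Gamma> x) = \<iota> x) \<and>
     \<Gamma> ` S = Cp"

text \<open>The real constants \<open>lam\<close>, \<open>f0\<close>, \<open>i0\<close> belong to the theory, whereas the reference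
  sounds \<open>x0\<close>, \<open>y0\<close> are interpreted in each model. The intensity and the timbre are only
  asserted to exist: the undefined concepts are \<open>lower\<close> and \<open>congr\<close>.\<close>

locale PI_model = interval_space S lower congr
  for lam f0 i0 :: real
    and S :: "'a set" and lower :: "('a \<times> 'a) set"
    and congr :: "(('a set \<times> 'a set) \<times> ('a set \<times> 'a set)) set" +
  fixes x0 y0 :: 'a
  assumes constants: "lam > 1" "f0 > 0" "i0 > 0"
    and reference_sounds: "x0 \<in> S" "y0 \<in> S" "(x0, y0) \<in> lower"
    and loudness_and_colour: "\<exists>\<iota> \<Gamma>.
          is_intensity S lower x0 i0 \<iota> \<and>
          is_timbre S (frequency S lower congr x0 y0 lam f0) \<iota> \<Gamma> \<and>
          (\<forall>x\<in>S. \<forall>y\<in>S. \<Gamma> x = \<Gamma> y \<longrightarrow> x = y)"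

definition is_isomorphism ::
  "'a set \<Rightarrow> ('a \<times> 'a) set \<Rightarrow> (('a set \<times> 'a set) \<times> ('a set \<times> 'a set)) set \<Rightarrow>
   'b set \<Rightarrow> ('b \<times> 'b) set \<Rightarrow> (('b set \<times> 'b set) \<times> ('b set \<times> 'b set)) set \<Rightarrow>
   ('a \<Rightarrow> 'b) \<Rightarrow> bool" where
  "is_isomorphism S1 lower1 congr1 S2 lower2 congr2 h \<longleftrightarrow>
     bij_betw h S1 S2 \<and>
     (\<forall>x\<in>S1. \<forall>y\<in>S1. (x, y) \<in> lower1 \<longleftrightarrow> (h x, h y) \<in> lower2) \<and>
     (\<forall>a\<in>S1. \<forall>b\<in>S1. \<forall>c\<in>S1. \<forall>d\<in>S1.
        (interval S1 lower1 a b, interval S1 lower1 c d) \<in> congr1 \<longleftrightarrow>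
        (interval S2 lower2 (h a) (h b), interval S2 lower2 (h c) (h d)) \<in> congr2)"

end

theory Submission
  imports Defs "HOL-Algebra.Group"
begin

text \<open>
  Categoricity rests on one observation: in a model, the frequency carries all the structure. Once
  the measure of intervals is known to exist, a sound is lower than another exactly when its
  frequency is smaller, and two intervals are congruent exactly when they have equal frequency
  ratios. The timbre identifies the sounds with the nonconstant continuous periodic functions and
  turns frequency into least period. So both undefined concepts can be read off the
  timbre in the same way in every model, and matching sounds of equal timbre is an isomorphism
  (\<open>PI_model_isomorphic\<close>). The reference sounds of the two models need not correspond under it.

  The frequency is defined through ``the'' measure of intervals, so the substance lies in showing
  that the axioms of pitch and interval determine exactly one measure
  (\<open>measure_exists_unique\<close>). After passing to pitch classes, the axioms describe a complete linear
  order with a congruence of intervals (locale \<open>pitch_line\<close>). Fixing an origin \<open>z\<close>,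
  a class \<open>b\<close> acts as the shift by the interval \<open>[z, b]\<close>; shifts compose, and
  the classes become an ordered abelian group. Dedekind's axiom makes the group Archimedean: if all
  multiples of a positive \<open>u\<close> stayed below some element, a cut would separate them from their upper
  bounds, and shifting the cut down by \<open>u\<close> gives a contradiction. By Hoelder's theorem
  (\<open>additive_exists\<close>, \<open>additive_unique\<close>) such a group has exactly one order-preserving homomorphism
  to the reals sending \<open>u\<close> to \<open>1\<close>. If \<open>u\<close> is the class of the second reference sound, a measure
  is the same thing as such a homomorphism \<open>\<phi>\<close>, through \<open>m [a, b] = lam powr (\<phi> b - \<phi> a)\<close>.

  For consistency, take the functions in \<^term>\<open>Cp\<close> as sounds that are their own timbre, order them
  by least period, and call intervals congruent when their ratios of least periods agree.
  Since the least period takes every positive value, this inherits the pitch and interval axioms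
  from the positive reals (locale \<open>frequency_coordinate\<close>), and uniqueness of the measure shows that
  the abstractly defined frequency is the least period.
\<close>

section \<open>Additive functions on Archimedean ordered groups\<close>

locale archimedean_group = comm_group G for G (structure) +
  fixes less :: "'a \<Rightarrow> 'a \<Rightarrow> bool" (infix "\<lless>" 50)
  assumes less_irrefl: "x \<in> carrier G \<Longrightarrow> \<not> x \<lless> x"
    and less_trans: "\<lbrakk>x \<in> carrier G; y \<in> carrier G; z \<in> carrier G; x \<lless> y; y \<lless> z\<rbrakk> \<Longrightarrow> x \<lless> z"
    and less_total: "\<lbrakk>x \<in> carrier G; y \<in> carrier G\<rbrakk> \<Longrightarrow> x \<lless> y \<or> x = y \<or> y \<lless> x"
    and mult_less: "\<lbrakk>x \<in> carrier G; y \<in> carrier G; z \<in> carrier G; x \<lless> y\<rbrakk> \<Longrightarrow> z \<otimes> x \<lless> z \<otimes> y"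
    and archimedean: "\<lbrakk>u \<in> carrier G; x \<in> carrier G; \<one> \<lless> u\<rbrakk> \<Longrightarrow> \<exists>n::nat. x \<lless> u [^] n"
begin

lemma less_asym: "\<lbrakk>x \<in> carrier G; y \<in> carrier G; x \<lless> y\<rbrakk> \<Longrightarrow> \<not> y \<lless> x"
  using less_irrefl less_trans by blast

lemma not_less_trans:
  "\<lbrakk>x \<in> carrier G; y \<in> carrier G; z \<in> carrier G; \<not> y \<lless> x; \<not> z \<lless> y\<rbrakk> \<Longrightarrow> \<not> z \<lless> x"
  using less_total less_trans by metis

lemma mult_less_mono:
  assumes "a \<in> carrier G" "b \<in> carrier G" "c \<in> carrier G" "d \<in> carrier G" "a \<lless> b" "c \<lless> d"
  shows "a \<otimes> c \<lless> b \<otimes> d"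
proof -
  have "a \<otimes> c \<lless> a \<otimes> d" using assms by (intro mult_less)
  moreover have "a \<otimes> d \<lless> b \<otimes> d"
    using mult_less[of a b d] assms by (simp add: m_comm)
  ultimately show ?thesis using assms less_trans[of "a \<otimes> c" "a \<otimes> d" "b \<otimes> d"] by simp
qed

lemma pow_less:
  assumes "x \<in> carrier G" "y \<in> carrier G" "x \<lless> y" "n > 0"
  shows "x [^] (n::nat) \<lless> y [^] n"
  using \<open>n > 0\<close>
proof (induction n)
  case (Suc n)
  then show ?case using assms by (cases "n = 0") (auto intro: mult_less_mono)
qed simp

lemma pow_less_iff:
  assumes "x \<in> carrier G" "y \<in> carrier G" "n > 0"
  shows "x [^] (n::nat) \<lless> y [^] n \<longleftrightarrow> x \<lless> y"
proof
  assume *: "x [^] n \<lless> y [^] n"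
  show "x \<lless> y"
  proof (rule ccontr)
    assume "\<not> x \<lless> y"
    then consider "x = y" | "y \<lless> x" using less_total assms by blast
    then show False
      using * pow_less[of y x n] less_asym[of "x [^] n" "y [^] n"] less_irrefl assms by cases auto
  qed
qed (use assms pow_less in auto)

lemma base_pow_less:
  assumes "u \<in> carrier G" "\<one> \<lless> u" "i < (j::int)"
  shows "u [^] i \<lless> u [^] j"
proof -
  have "\<one> [^] nat (j - i) \<lless> u [^] nat (j - i)" using assms by (intro pow_less) auto
  then have "\<one> \<lless> u [^] (j - i)"
    using assms int_pow_int[of G u "nat (j - i)"] by simp
  then have "u [^] i \<otimes> \<one> \<lless> u [^] i \<otimes> u [^] (j - i)" using assms by (intro mult_less) auto
  then show ?thesis using assms by (simp flip: int_pow_mult)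
qed

lemma base_pow_not_less_iff:
  assumes "u \<in> carrier G" "\<one> \<lless> u"
  shows "\<not> u [^] j \<lless> u [^] (i::int) \<longleftrightarrow> i \<le> j"
  using base_pow_less[OF assms, of i j] base_pow_less[OF assms, of j i] assms
    less_asym[of "u [^] i" "u [^] j"] less_irrefl[of "u [^] i"]
  by (cases i j rule: linorder_cases) auto

text \<open>Clearing denominators: raising both comparisons to the common exponent \<open>q * q'\<close> sandwiches
  a power of \<open>g\<close> between two powers of \<open>u\<close>.\<close>
lemma cut_le:
  assumes "u \<in> carrier G" "\<one> \<lless> u" "g \<in> carrier G" "q > 0" "q' > 0"
    and lower: "\<not> g [^] (q::nat) \<lless> u [^] (p::int)"
    and upper: "\<not> u [^] (p'::int) \<lless> g [^] (q'::nat)"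
  shows "real_of_int p / real q \<le> real_of_int p' / real q'"
proof -
  have "\<not> (g [^] q) [^] q' \<lless> (u [^] p) [^] q'"
    using lower assms by (simp add: pow_less_iff)
  then have 1: "\<not> g [^] (q * q') \<lless> u [^] (p * int q')"
    using assms by (simp add: nat_pow_pow int_pow_pow flip: int_pow_int)
  have "\<not> (u [^] p') [^] q \<lless> (g [^] q') [^] q"
    using upper assms by (simp add: pow_less_iff)
  then have 2: "\<not> u [^] (p' * int q) \<lless> g [^] (q * q')"
    using assms by (simp add: nat_pow_pow int_pow_pow mult.commute flip: int_pow_int)
  have "\<not> u [^] (p' * int q) \<lless> u [^] (p * int q')"
    using not_less_trans[OF _ _ _ 1 2] assms by simp
  then have "p * int q' \<le> p' * int q" using assms by (simp add: base_pow_not_less_iff)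
  then have "real_of_int (p * int q') \<le> real_of_int (p' * int q)" by linarith
  then show ?thesis using assms by (simp add: field_simps)
qed

text \<open>The Archimedean property for \<open>g\<close> and for its inverse bounds \<open>g\<close> between two powers of
  \<open>u\<close>; between them there is a last power of \<open>u\<close> not exceeding \<open>g\<close>.\<close>
lemma integer_part:
  assumes "u \<in> carrier G" "\<one> \<lless> u" "g \<in> carrier G"
  obtains p :: int where "\<not> g \<lless> u [^] p" "g \<lless> u [^] (p + 1)"
proof -
  obtain n :: nat where n: "g \<lless> u [^] n" using archimedean assms by blast
  obtain m :: nat where m: "inv g \<lless> u [^] m" using archimedean[of u "inv g"] assms by auto
  have "g \<otimes> u [^] (- int m) \<otimes> inv g \<lless> g \<otimes> u [^] (- int m) \<otimes> u [^] m"
    using m assms by (intro mult_less) auto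
  moreover have "g \<otimes> u [^] (- int m) \<otimes> inv g = u [^] (- int m)"
    using assms by (simp add: m_comm[of g] m_assoc)
  moreover have "g \<otimes> u [^] (- int m) \<otimes> u [^] m = g"
    using assms by (simp add: m_assoc int_pow_neg int_pow_int)
  ultimately have low: "u [^] (- int m) \<lless> g" by simp
  define Q where "Q j = (g \<lless> u [^] (int j - int m))" for j
  define j where "j = (LEAST j. Q j)"
  have "Q (n + m)" using n by (simp add: Q_def int_pow_int)
  then have Qj: "Q j" unfolding j_def by (rule LeastI)
  have "\<not> Q 0" using low assms less_asym[of "u [^] (- int m)" g] by (simp add: Q_def)
  then have "j > 0" using Qj by (cases j) auto
  then have nQ: "\<not> Q (j - 1)" unfolding j_def using not_less_Least by (metis diff_less zero_less_one)
  show thesis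
  proof (rule that)
    show "\<not> g \<lless> u [^] (int j - int m - 1)"
      using nQ \<open>j > 0\<close> by (simp add: Q_def of_nat_diff algebra_simps)
    show "g \<lless> u [^] (int j - int m - 1 + 1)" using Qj by (simp add: Q_def)
  qed
qed

text \<open>The order-preserving homomorphisms to the additive group of the reals.\<close>
definition additive :: "('a \<Rightarrow> real) \<Rightarrow> bool" where
  "additive \<phi> \<longleftrightarrow> (\<forall>x\<in>carrier G. \<forall>y\<in>carrier G. \<phi> (x \<otimes> y) = \<phi> x + \<phi> y) \<and>
     (\<forall>x\<in>carrier G. \<forall>y\<in>carrier G. x \<lless> y \<longrightarrow> \<phi> x < \<phi> y)"

lemma additive_one: "additive \<phi> \<Longrightarrow> \<phi> \<one> = 0"
  unfolding additive_def by (metis add_cancel_right_right one_closed r_one)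

lemma additive_less_iff:
  assumes "additive \<phi>" "x \<in> carrier G" "y \<in> carrier G"
  shows "\<phi> x < \<phi> y \<longleftrightarrow> x \<lless> y"
  using assms less_total[of x y] unfolding additive_def by (metis less_irrefl order_less_asym)

lemma additive_eq_iff:
  assumes "additive \<phi>" "x \<in> carrier G" "y \<in> carrier G"
  shows "\<phi> x = \<phi> y \<longleftrightarrow> x = y"
  using assms less_total[of x y] additive_less_iff[OF assms] additive_less_iff[OF assms(1,3,2)] by auto

lemma additive_pow:
  assumes "additive \<phi>" "x \<in> carrier G"
  shows "\<phi> (x [^] (n::nat)) = n * \<phi> x"
proof (induction n)
  case (Suc n)
  then show ?case using assms(1)[unfolded additive_def] assms(2) by (simp add: algebra_simps)
qed (use additive_one[OF assms(1)] in simp)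

lemma additive_int_pow:
  assumes "additive \<phi>" "x \<in> carrier G"
  shows "\<phi> (x [^] (i::int)) = i * \<phi> x"
proof (cases "i \<ge> 0")
  case True
  then show ?thesis using additive_pow[OF assms, of "nat i"] by (simp add: pow_nat)
next
  case False
  have "x [^] i \<otimes> x [^] nat (- i) = \<one>"
    using assms False by (simp add: int_pow_mult[symmetric] flip: int_pow_int)
  then have "\<phi> (x [^] i) + \<phi> (x [^] nat (- i)) = 0"
    using assms additive_one[OF assms(1)] unfolding additive_def by (metis int_pow_closed nat_pow_closed)
  then show ?thesis using additive_pow[OF assms, of "nat (- i)"] False by simp
qed

text \<open>An order-preserving homomorphism turns the comparison of powers of \<open>g\<close> with powers of \<open>u\<close>
  into the comparison of its value at \<open>g\<close> with rational multiples of its value at \<open>u\<close>. The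
  left-hand side does not mention \<open>\<phi>\<close>, whence the uniqueness below.\<close>
lemma additive_cut:
  assumes "additive \<phi>" "u \<in> carrier G" "g \<in> carrier G"
  shows "g [^] (q::nat) \<lless> u [^] (p::int) \<longleftrightarrow> q * \<phi> g < p * \<phi> u"
  using additive_less_iff[OF assms(1), of "g [^] q" "u [^] p"] additive_pow[OF assms(1,3)]
    additive_int_pow[OF assms(1,2)] assms by simp

lemma additive_le:
  assumes "additive \<phi>" "additive \<psi>" "u \<in> carrier G" "\<one> \<lless> u" "\<phi> u = \<psi> u" "g \<in> carrier G"
  shows "\<psi> g \<le> \<phi> g"
proof (rule ccontr)
  assume "\<not> \<psi> g \<le> \<phi> g"
  have c: "\<phi> u > 0" using additive_less_iff[OF assms(1), of \<one> u] additive_one[OF assms(1)] assms by simp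
  then have "\<phi> g / \<phi> u < \<psi> g / \<phi> u"
    using \<open>\<not> \<psi> g \<le> \<phi> g\<close> by (simp add: divide_strict_right_mono)
  then obtain r where r: "r \<in> \<rat>" "\<phi> g / \<phi> u < r" "r < \<psi> g / \<phi> u"
    using Rats_dense_in_real by blast
  obtain p :: int and q' :: int where pq': "q' > 0" "r = p / q'"
    using r(1) by (auto elim: Rats_cases')
  obtain q :: nat where "q > 0" "r = p / q"
    using pq' by (intro that[of "nat q'"]) auto
  moreover have "q * \<phi> g < q * (r * \<phi> u)" "q * (r * \<phi> u) < q * \<psi> g"
    using r c \<open>q > 0\<close> by (simp_all add: field_simps)
  ultimately have "q * \<phi> g < p * \<phi> u" "p * \<phi> u < q * \<psi> g" by simp_all
  then show False
    using additive_cut[OF assms(1,3,6), of q p] additive_cut[OF assms(2,3,6), of q p] assms by simp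
qed

theorem additive_unique:
  assumes "additive \<phi>" "additive \<psi>" "u \<in> carrier G" "\<one> \<lless> u" "\<phi> u = \<psi> u" "g \<in> carrier G"
  shows "\<phi> g = \<psi> g"
  using additive_le[OF assms] additive_le[OF assms(2,1,3,4) _ assms(6)] assms by simp

text \<open>Hoelder's theorem. The value at \<open>g\<close> is the real number whose lower Dedekind cut consists of
  the \<open>p / q\<close> with \<open>u\<close> to the \<open>p\<close> at most \<open>g\<close> to the \<open>q\<close>. Replacing \<open>g\<close> by its \<open>n\<close>-th
  power and rounding down to a power of \<open>u\<close> finds the value up to \<open>1 / n\<close>; rounding commutes
  with products up to a bounded error, so additivity holds up to \<open>2 / n\<close> for every \<open>n\<close>.\<close>
theorem additive_exists:
  assumes "u \<in> carrier G" "\<one> \<lless> u"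
  obtains \<phi> where "additive \<phi>" "\<phi> u = 1"
proof -
  define L where "L g = {real_of_int p / real q | p (q::nat). q > 0 \<and> \<not> g [^] q \<lless> u [^] p}" for g
  define \<phi> where "\<phi> g = Sup (L g)" for g
  have lower_upper: "p / q \<le> \<phi> g \<and> \<phi> g \<le> p' / q'"
    if "g \<in> carrier G" "q > 0" "\<not> g [^] q \<lless> u [^] p" "q' > 0" "\<not> u [^] p' \<lless> g [^] q'"
    for g and p p' :: int and q q' :: nat
  proof -
    have bound: "x \<le> p' / q'" if "x \<in> L g" for x
      using that cut_le[OF assms \<open>g \<in> carrier G\<close> _ \<open>q' > 0\<close> _ \<open>\<not> u [^] p' \<lless> g [^] q'\<close>] by (auto simp: L_def)
    have "p / q \<in> L g" using that unfolding L_def by blast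
    then show ?thesis
      unfolding \<phi>_def using bound by (metis bdd_above.I cSup_least cSup_upper empty_iff)
  qed
  have approx: "\<exists>p::int. p / n \<le> \<phi> g \<and> \<phi> g \<le> (p + 1) / n \<and>
      \<not> g [^] n \<lless> u [^] p \<and> g [^] n \<lless> u [^] (p + 1)"
    if "g \<in> carrier G" "n > 0" for g and n :: nat
  proof -
    obtain p :: int where p: "\<not> g [^] n \<lless> u [^] p" "g [^] n \<lless> u [^] (p + 1)"
      using integer_part[OF assms, of "g [^] n"] \<open>g \<in> carrier G\<close> by auto
    then have "\<not> u [^] (p + 1) \<lless> g [^] n" using assms that less_asym by simp
    then show ?thesis using lower_upper[OF that p(1) that(2), of "p + 1"] p by auto
  qed
  have add: "\<phi> (g \<otimes> h) = \<phi> g + \<phi> h" if gh: "g \<in> carrier G" "h \<in> carrier G" for g h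
  proof -
    have close: "\<bar>\<phi> (g \<otimes> h) - (\<phi> g + \<phi> h)\<bar> \<le> 2 / n" if n: "n > 0" for n :: nat
    proof -
      obtain p :: int where p: "p / n \<le> \<phi> g" "\<phi> g \<le> (p + 1) / n"
          "\<not> g [^] n \<lless> u [^] p" "g [^] n \<lless> u [^] (p + 1)"
        using approx[OF gh(1) n] by blast
      obtain r :: int where r: "r / n \<le> \<phi> h" "\<phi> h \<le> (r + 1) / n"
          "\<not> h [^] n \<lless> u [^] r" "h [^] n \<lless> u [^] (r + 1)"
        using approx[OF gh(2) n] by blast
      have gh_n: "(g \<otimes> h) [^] n = g [^] n \<otimes> h [^] n" using gh by (simp add: pow_mult_distrib m_comm)
      have "g [^] n \<otimes> h [^] n \<lless> u [^] (p + 1) \<otimes> u [^] (r + 1)"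
        using p r gh assms by (intro mult_less_mono) auto
      then have "(g \<otimes> h) [^] n \<lless> u [^] (p + r + 2)"
        using gh_n assms by (simp add: algebra_simps flip: int_pow_mult)
      then have up: "\<not> u [^] (p + r + 2) \<lless> (g \<otimes> h) [^] n" using gh assms less_asym by simp
      have "\<not> h [^] n \<otimes> g [^] n \<lless> h [^] n \<otimes> u [^] p"
        using p(3) gh assms mult_less[of "h [^] n \<otimes> g [^] n" "h [^] n \<otimes> u [^] p" "inv (h [^] n)"]
        by (auto simp: m_assoc[symmetric])
      moreover have "\<not> u [^] p \<otimes> h [^] n \<lless> u [^] p \<otimes> u [^] r"
        using r(3) gh assms mult_less[of "u [^] p \<otimes> h [^] n" "u [^] p \<otimes> u [^] r" "inv (u [^] p)"]
        by (auto simp: m_assoc[symmetric])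
      ultimately have "\<not> (g \<otimes> h) [^] n \<lless> u [^] p \<otimes> u [^] r"
        using not_less_trans[of "u [^] p \<otimes> u [^] r" "u [^] p \<otimes> h [^] n" "g [^] n \<otimes> h [^] n"] gh assms gh_n
        by (simp add: m_comm)
      then have low: "\<not> (g \<otimes> h) [^] n \<lless> u [^] (p + r)" using assms by (simp add: int_pow_mult)
      have "(p + r) / n \<le> \<phi> (g \<otimes> h) \<and> \<phi> (g \<otimes> h) \<le> (p + r + 2) / n"
        using lower_upper[OF _ n low n up] gh by simp
      then show ?thesis using p(1,2) r(1,2) by (simp add: add_divide_distrib abs_le_iff)
    qed
    have "\<bar>\<phi> (g \<otimes> h) - (\<phi> g + \<phi> h)\<bar> \<le> 0"
    proof (rule field_le_epsilon)
      fix e :: real assume "e > 0"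
      then obtain n :: nat where n: "n > 0" "inverse n < e / 2"
        using ex_inverse_of_nat_less[of "e / 2"] by auto
      then have "2 / real n < e" by (simp add: field_simps)
      then show "\<bar>\<phi> (g \<otimes> h) - (\<phi> g + \<phi> h)\<bar> \<le> 0 + e" using close[OF n(1)] by linarith
    qed
    then show ?thesis by simp
  qed
  have pos: "\<phi> g > 0" if g: "g \<in> carrier G" "\<one> \<lless> g" for g
  proof -
    obtain n :: nat where n: "u \<lless> g [^] n" using archimedean[OF g(1) assms(1) g(2)] by blast
    have "n > 0"
    proof (rule gr0I)
      assume "n = 0"
      then show False using n assms less_asym[of u \<one>] by simp
    qed
    have 1: "\<not> g [^] n \<lless> u [^] (1::int)" using n g assms less_asym by (simp add: int_pow_1)
    obtain p :: int where "g [^] n \<lless> u [^] (p + 1)" using approx[OF g(1) \<open>n > 0\<close>] by blast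
    then have "\<not> u [^] (p + 1) \<lless> g [^] n" using g assms less_asym by simp
    then have "1 / n \<le> \<phi> g" using lower_upper[OF g(1) \<open>n > 0\<close> 1 \<open>n > 0\<close>] by simp
    then show ?thesis using \<open>n > 0\<close> by (simp add: less_le_trans[of 0 "1 / real n"])
  qed
  have mono: "\<phi> g < \<phi> h" if "g \<in> carrier G" "h \<in> carrier G" "g \<lless> h" for g h
  proof -
    have "inv g \<otimes> g \<lless> inv g \<otimes> h" using that by (intro mult_less) auto
    then have "\<phi> (inv g \<otimes> h) > 0" using pos that by simp
    moreover have "\<phi> h = \<phi> g + \<phi> (inv g \<otimes> h)"
      using add[of g "inv g \<otimes> h"] that by (simp add: m_assoc[symmetric])
    ultimately show ?thesis by simp
  qed
  have "additive \<phi>" using add mono by (simp add: additive_def)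
  moreover have "\<phi> u = 1"
    using lower_upper[of u 1 1 1 1] assms less_irrefl[of u] by (simp add: int_pow_1)
  ultimately show thesis by (rule that)
qed

end

section \<open>The group of shifts of a pitch line\<close>

text \<open>The axioms for pitch and intervals as they read on pitch classes, where sounds of the same
  pitch have become equal; \<open>eqv a b c d\<close> stands for the congruence of \<open>[a, b]\<close> and \<open>[c, d]\<close>.
  The class \<open>z\<close> is an arbitrary origin.\<close>
locale pitch_line =
  fixes K :: "'k set" and less :: "'k \<Rightarrow> 'k \<Rightarrow> bool" (infix "\<lless>" 50)
    and eqv :: "'k \<Rightarrow> 'k \<Rightarrow> 'k \<Rightarrow> 'k \<Rightarrow> bool" and z :: 'k
  assumes origin: "z \<in> K"
    and irrefl: "a \<in> K \<Longrightarrow> \<not> a \<lless> a"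
    and trans: "\<lbrakk>a \<in> K; b \<in> K; c \<in> K; a \<lless> b; b \<lless> c\<rbrakk> \<Longrightarrow> a \<lless> c"
    and total: "\<lbrakk>a \<in> K; b \<in> K\<rbrakk> \<Longrightarrow> a \<lless> b \<or> a = b \<or> b \<lless> a"
    and unbounded: "a \<in> K \<Longrightarrow> \<exists>b\<in>K. a \<lless> b"
    and eqv_refl: "\<lbrakk>a \<in> K; b \<in> K\<rbrakk> \<Longrightarrow> eqv a b a b"
    and eqv_trans: "\<lbrakk>a \<in> K; b \<in> K; c \<in> K; d \<in> K; e \<in> K; f \<in> K; eqv a b c d; eqv c d e f\<rbrakk>
          \<Longrightarrow> eqv a b e f"
    and transport: "\<lbrakk>a \<in> K; b \<in> K; c \<in> K\<rbrakk> \<Longrightarrow> \<exists>d\<in>K. eqv a b c d"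
    and transport_unique: "\<lbrakk>a \<in> K; b \<in> K; c \<in> K; d \<in> K; e \<in> K; eqv a b c d; eqv a b c e\<rbrakk>
          \<Longrightarrow> d = e"
    and eqv_less: "\<lbrakk>a \<in> K; b \<in> K; c \<in> K; d \<in> K; a \<lless> b; eqv a b c d\<rbrakk> \<Longrightarrow> c \<lless> d"
    and eqv_inverse_iff: "\<lbrakk>a \<in> K; b \<in> K; c \<in> K; d \<in> K; a \<lless> b\<rbrakk> \<Longrightarrow> eqv a b c d \<longleftrightarrow> eqv b a d c"
    and eqv_compose_up: "\<lbrakk>a \<in> K; b \<in> K; c \<in> K; a' \<in> K; b' \<in> K; c' \<in> K; a \<lless> b; b \<lless> c;
          eqv a b a' b'; eqv b c b' c'\<rbrakk> \<Longrightarrow> eqv a c a' c'"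
    and eqv_compose_swap: "\<lbrakk>a \<in> K; b \<in> K; c \<in> K; a' \<in> K; b' \<in> K; c' \<in> K; a \<lless> b; b \<lless> c;
          eqv a b b' a'; eqv b c c' b'\<rbrakk> \<Longrightarrow> eqv a c c' a'"
    and cut: "\<lbrakk>P \<union> Q = K; P \<inter> Q = {}; P \<noteq> {}; Q \<noteq> {}; \<forall>q\<in>Q. \<forall>p\<in>P. \<not> q \<lless> p\<rbrakk>
          \<Longrightarrow> \<exists>\<theta>\<in>K. (\<forall>s\<in>K. s \<lless> \<theta> \<longrightarrow> s \<in> P) \<and> (\<forall>s\<in>K. \<theta> \<lless> s \<longrightarrow> s \<in> Q)"
begin

text \<open>Transport \<open>[c, d]\<close> back to the starting point \<open>a\<close>: by transitivity the result is also
  congruent to \<open>[a, b]\<close>, and transport is unique.\<close>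
lemma eqv_sym:
  assumes "a \<in> K" "b \<in> K" "c \<in> K" "d \<in> K" "eqv a b c d"
  shows "eqv c d a b"
proof -
  obtain e where e: "e \<in> K" "eqv c d a e" using transport[of c d a] assms by blast
  then have "eqv a b a e" using eqv_trans[of a b c d a e] assms by blast
  then have "e = b" using transport_unique[of a b a e b] eqv_refl e assms by blast
  then show ?thesis using e by simp
qed

text \<open>A nondegenerate interval congruent to \<open>[a, a]\<close> would, itself or reversed, be an ascending
  interval, whereas intervals congruent to ascending ones ascend.\<close>
lemma eqv_degenerate:
  assumes "a \<in> K" "c \<in> K" "d \<in> K" "eqv a a c d"
  shows "c = d"
proof -
  have *: "eqv c d a a" using eqv_sym assms by blast
  then have "\<not> c \<lless> d" using eqv_less[of c d a a] irrefl assms by blast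
  moreover have "\<not> d \<lless> c"
    using eqv_inverse_iff[of d c a a] eqv_less[of d c a a] irrefl assms * by blast
  ultimately show ?thesis using total assms by blast
qed

lemma eqv_degenerateI: "\<lbrakk>a \<in> K; c \<in> K\<rbrakk> \<Longrightarrow> eqv a a c c"
  using transport[of a a c] eqv_degenerate by blast

lemma eqv_inverse:
  assumes "a \<in> K" "b \<in> K" "c \<in> K" "d \<in> K" "eqv a b c d"
  shows "eqv b a d c"
proof -
  consider "a \<lless> b" | "a = b" | "b \<lless> a" using total assms by blast
  then show ?thesis
  proof cases
    case 1
    then show ?thesis using eqv_inverse_iff[of a b c d] assms by simp
  next
    case 2
    then show ?thesis using eqv_degenerate[of a c d] assms by auto
  next
    case 3
    then show ?thesis using eqv_inverse_iff[of b a d c] assms by simp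
  qed
qed

text \<open>The composition axiom only speaks of ascending intervals. Since transport is unique, it can be
  cancelled on either side; these two rules and reversal extend it to all positions of the
  three points.\<close>
lemma eqv_cancel_left:
  assumes K: "a \<in> K" "b \<in> K" "c \<in> K" "a' \<in> K" "b' \<in> K" "c' \<in> K"
    and "a \<lless> b" "b \<lless> c" "eqv a b a' b'" "eqv a c a' c'"
  shows "eqv b c b' c'"
proof -
  obtain d where d: "d \<in> K" "eqv b c b' d" using transport[of b c b'] K by blast
  then have "eqv a c a' d" using eqv_compose_up[of a b c a' b' d] assms by blast
  then have "d = c'" using transport_unique[of a c a' d c'] d assms by blast
  then show ?thesis using d by simp
qed

lemma eqv_cancel_right:
  assumes K: "a \<in> K" "b \<in> K" "c \<in> K" "a' \<in> K" "b' \<in> K" "c' \<in> K"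
    and "a \<lless> b" "b \<lless> c" "eqv a c a' c'" "eqv b c b' c'"
  shows "eqv a b a' b'"
proof -
  obtain d where d: "d \<in> K" "eqv a b a' d" using transport[of a b a'] K by blast
  then have "eqv b c d c'" using eqv_cancel_left[of a b c a' d c'] assms by blast
  then have "eqv c b c' d" "eqv c b c' b'" using eqv_inverse assms d by auto
  then have "d = b'" using transport_unique[of c b c' d b'] d assms by blast
  then show ?thesis using d by simp
qed

lemma eqv_compose:
  assumes K: "a \<in> K" "b \<in> K" "c \<in> K" "a' \<in> K" "b' \<in> K" "c' \<in> K"
    and ab: "eqv a b a' b'" and bc: "eqv b c b' c'"
  shows "eqv a c a' c'"
proof -
  have ba: "eqv b a b' a'" and cb: "eqv c b c' b'" using eqv_inverse assms by auto
  consider "a = b" | "b = c" | "a = c" | "a \<lless> b" "b \<lless> c" | "c \<lless> b" "b \<lless> a"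
    | "a \<lless> c" "c \<lless> b" | "c \<lless> a" "a \<lless> b" | "b \<lless> a" "a \<lless> c" | "b \<lless> c" "c \<lless> a"
    using total[of a b] total[of b c] total[of a c] K by blast
  then show ?thesis
  proof cases
    case 1
    then show ?thesis using eqv_degenerate[of a a' b'] ab bc K by simp
  next
    case 2
    then show ?thesis using eqv_degenerate[of b b' c'] ab bc K by simp
  next
    case 3
    then have "a' = c'" using transport_unique[of b a b' a' c'] ba bc K by blast
    then show ?thesis using 3 eqv_degenerateI K by simp
  next
    case 4
    then show ?thesis using eqv_compose_up[of a b c a' b' c'] assms by blast
  next
    case 5
    then have "eqv c a c' a'" using eqv_compose_up[of c b a c' b' a'] K ba cb by blast
    then show ?thesis using eqv_inverse K by blast
  next
    case 6
    then show ?thesis using eqv_cancel_right[of a c b a' c' b'] K ab cb by blast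
  next
    case 7
    then have "eqv c a c' a'" using eqv_cancel_right[of c a b c' a' b'] K ab cb by blast
    then show ?thesis using eqv_inverse K by blast
  next
    case 8
    then show ?thesis using eqv_cancel_left[of b a c b' a' c'] K ba bc by blast
  next
    case 9
    then have "eqv c a c' a'" using eqv_cancel_left[of b c a b' c' a'] K ba bc by blast
    then show ?thesis using eqv_inverse K by blast
  qed
qed

text \<open>The point reached from \<open>a\<close> by the interval \<open>[z, b]\<close>. This is the group operation; it makes
  transport from the origin into a translation.\<close>
definition shift :: "'k \<Rightarrow> 'k \<Rightarrow> 'k" where
  "shift a b = (SOME c. c \<in> K \<and> eqv z b a c)"

definition shift_group :: "'k monoid" where
  "shift_group = \<lparr>carrier = K, mult = shift, one = z\<rparr>"

lemma shift_group_simps [simp]: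
  "carrier shift_group = K" "a \<otimes>\<^bsub>shift_group\<^esub> b = shift a b" "\<one>\<^bsub>shift_group\<^esub> = z"
  by (simp_all add: shift_group_def)

lemma shift:
  assumes "a \<in> K" "b \<in> K"
  shows shift_closed: "shift a b \<in> K" and shift_eqv: "eqv z b a (shift a b)"
  using someI_ex[of "\<lambda>c. c \<in> K \<and> eqv z b a c"] transport[of z b a] origin assms
  unfolding shift_def by blast+

lemma shift_eqI: "\<lbrakk>a \<in> K; b \<in> K; c \<in> K; eqv z b a c\<rbrakk> \<Longrightarrow> shift a b = c"
  using transport_unique[of z b a] shift origin by blast

text \<open>Shifts preserve intervals: descend from \<open>b\<close> to the origin and ascend to \<open>c\<close>, and compare
  with the path from \<open>shift a b\<close> through \<open>a\<close> to \<open>shift a c\<close>.\<close>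
lemma shift_eqv_shift:
  assumes "a \<in> K" "b \<in> K" "c \<in> K"
  shows "eqv b c (shift a b) (shift a c)"
  using eqv_compose[of b z c "shift a b" a "shift a c"] eqv_inverse[of z b a "shift a b"]
    shift origin assms by blast

lemma shift_group: "group shift_group"
proof (rule groupI; simp add: origin shift_closed)
  fix a b c assume K: "a \<in> K" "b \<in> K" "c \<in> K"
  have "eqv z (shift b c) a (shift (shift a b) c)"
  proof (rule eqv_compose[of z b _ a "shift a b"])
    show "eqv b (shift b c) (shift a b) (shift (shift a b) c)"
      by (rule eqv_trans[of _ _ z c]) (use K origin shift_closed shift_eqv eqv_sym in auto)
  qed (use K origin shift_closed shift_eqv in auto)
  then show "shift (shift a b) c = shift a (shift b c)"
    using shift_eqI[of a "shift b c" "shift (shift a b) c"] K shift_closed by simp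
next
  fix a assume a: "a \<in> K"
  show "shift z a = a" using a origin eqv_refl shift_eqI by blast
  obtain b where b: "b \<in> K" "eqv a z z b" using transport[of a z z] origin a by blast
  then have "eqv z a b z" using eqv_inverse a origin by blast
  then show "\<exists>b\<in>K. shift b a = z" using b a origin shift_eqI by blast
qed

text \<open>Commutativity is the content of the axiom on composing with inverse intervals: climbing by
  \<open>a\<close> and then by \<open>b\<close> is compared with descending from \<open>shift b a\<close> through \<open>b\<close> to the origin.\<close>
lemma shift_commute_positive:
  assumes "a \<in> K" "b \<in> K" "z \<lless> a" "z \<lless> b"
  shows "shift a b = shift b a"
proof -
  note ab = shift_closed[OF assms(1,2)] shift_eqv[OF assms(1,2)]
  note ba = shift_closed[OF assms(2,1)] shift_eqv[OF assms(2,1)]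
  have "a \<lless> shift a b" using eqv_less[of z b a "shift a b"] ab assms origin by simp
  moreover have "eqv a (shift a b) z b" using eqv_sym[of z b a "shift a b"] ab assms origin by simp
  ultimately have "eqv z (shift a b) z (shift b a)"
    using eqv_compose_swap[of z a "shift a b" "shift b a" b z] ab ba assms origin by simp
  then show ?thesis
    using transport_unique[of z "shift a b" z "shift a b" "shift b a"]
      eqv_refl[of z "shift a b"] ab ba assms origin by simp
qed

lemma shift_less:
  assumes "a \<in> K" "b \<in> K" "c \<in> K" "b \<lless> c"
  shows "shift a b \<lless> shift a c"
  using eqv_less[of b c "shift a b" "shift a c"] shift_eqv_shift shift_closed assms by simp

sublocale shift: group shift_group
  rewrites "carrier shift_group = K" and "mult shift_group = shift" and "one shift_group = z"
  by (rule shift_group) (simp_all add: shift_group_def)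

lemma inverse_positive:
  assumes "a \<in> K" "a \<lless> z"
  shows "z \<lless> m_inv shift_group a"
  using shift_less[of "m_inv shift_group a" a z] assms origin by simp

lemma commute_inverse:
  assumes "a \<in> K" "b \<in> K" "shift (m_inv shift_group a) b = shift b (m_inv shift_group a)"
  shows "shift a b = shift b a"
proof -
  have "shift a b = shift (shift a (shift b (m_inv shift_group a))) a"
    using assms(1,2) by (simp add: shift.m_assoc)
  also have "\<dots> = shift (shift a (shift (m_inv shift_group a) b)) a" by (simp only: assms(3))
  also have "\<dots> = shift b a" using assms(1,2) by (simp add: shift.m_assoc[symmetric])
  finally show ?thesis .
qed

lemma shift_commute:
  assumes "a \<in> K" "b \<in> K"
  shows "shift a b = shift b a"
proof -
  have pos: "shift a b = shift b a" if "a \<in> K" "b \<in> K" "z \<lless> a" for a b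
  proof -
    consider "z \<lless> b" | "z = b" | "b \<lless> z" using total[OF origin \<open>b \<in> K\<close>] by blast
    then show ?thesis
    proof cases
      case 3
      have "shift (m_inv shift_group b) a = shift a (m_inv shift_group b)"
        by (rule shift_commute_positive) (use 3 that inverse_positive in auto)
      from commute_inverse[OF that(2,1) this] show ?thesis by (rule sym)
    next
      case 2
      show ?thesis using that unfolding 2[symmetric] by simp
    qed (rule shift_commute_positive[OF that])
  qed
  consider "z \<lless> a" | "z = a" | "a \<lless> z" using total[OF origin assms(1)] by blast
  then show ?thesis
  proof cases
    case 3
    show ?thesis
      by (rule commute_inverse[OF assms pos]) (use 3 assms inverse_positive in auto)
  next
    case 2
    show ?thesis using assms unfolding 2[symmetric] by simp
  qed (rule pos[OF assms])
qed

text \<open>Otherwise the elements below some multiple of \<open>u\<close> form a proper initial segment. Its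
  boundary \<open>\<theta>\<close>, lowered by \<open>u\<close>, lies below some multiple of \<open>u\<close>, so \<open>\<theta>\<close> lies strictly below
  the next one, which then belongs to both parts of the cut.\<close>
lemma shift_archimedean:
  assumes "u \<in> K" "g \<in> K" "z \<lless> u"
  shows "\<exists>n::nat. g \<lless> u [^]\<^bsub>shift_group\<^esub> n"
proof (rule ccontr)
  assume bounded: "\<nexists>n::nat. g \<lless> u [^]\<^bsub>shift_group\<^esub> n"
  define P where "P = {s\<in>K. \<exists>n::nat. s \<lless> u [^]\<^bsub>shift_group\<^esub> n}"
  define Q where "Q = K - P"
  have PQ: "P \<union> Q = K" "P \<inter> Q = {}" by (auto simp: P_def Q_def)
  have "z \<in> P" using assms origin by (auto simp: P_def intro!: exI[of _ 1])
  have "g \<in> Q" using bounded assms by (simp add: P_def Q_def)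
  have below: "\<not> q \<lless> p" if "q \<in> Q" "p \<in> P" for p q
  proof
    assume "q \<lless> p"
    from that(2) obtain n :: nat where "p \<lless> u [^]\<^bsub>shift_group\<^esub> n" by (auto simp: P_def)
    then have "q \<lless> u [^]\<^bsub>shift_group\<^esub> n"
      using trans[OF _ _ _ \<open>q \<lless> p\<close>] that assms by (simp add: P_def Q_def)
    then show False using that by (auto simp: P_def Q_def)
  qed
  have "\<exists>\<theta>\<in>K. (\<forall>s\<in>K. s \<lless> \<theta> \<longrightarrow> s \<in> P) \<and> (\<forall>s\<in>K. \<theta> \<lless> s \<longrightarrow> s \<in> Q)"
    by (rule cut[OF PQ]) (use \<open>z \<in> P\<close> \<open>g \<in> Q\<close> below in auto)
  then obtain \<theta> where \<theta>: "\<theta> \<in> K" "\<And>s. s \<in> K \<Longrightarrow> s \<lless> \<theta> \<Longrightarrow> s \<in> P"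
      "\<And>s. s \<in> K \<Longrightarrow> \<theta> \<lless> s \<Longrightarrow> s \<in> Q"
    by blast
  define \<eta> where "\<eta> = shift \<theta> (m_inv shift_group u)"
  have \<eta>: "\<eta> \<in> K" "shift u \<eta> = \<theta>"
    using \<theta> assms by (simp_all add: \<eta>_def shift_commute[of u] shift.m_assoc)
  have "shift \<eta> z \<lless> shift \<eta> u" using \<eta> assms origin by (intro shift_less)
  then have "\<eta> \<lless> \<theta>" using \<eta> assms by (simp add: shift_commute[of u])
  then obtain n :: nat where n: "\<eta> \<lless> u [^]\<^bsub>shift_group\<^esub> n" using \<theta>(2) \<eta> by (auto simp: P_def)
  have "shift u \<eta> \<lless> shift u (u [^]\<^bsub>shift_group\<^esub> n)" using \<eta> n assms by (intro shift_less) auto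
  then have up: "\<theta> \<lless> u [^]\<^bsub>shift_group\<^esub> Suc n"
    using \<eta> assms by (simp add: shift_commute[of u])
  have "shift (u [^]\<^bsub>shift_group\<^esub> Suc n) z \<lless> shift (u [^]\<^bsub>shift_group\<^esub> Suc n) u"
    using assms origin by (intro shift_less) (auto simp del: shift.nat_pow_Suc)
  then have "u [^]\<^bsub>shift_group\<^esub> Suc n \<lless> u [^]\<^bsub>shift_group\<^esub> Suc (Suc n)"
    using assms by (simp add: shift_closed)
  then have "u [^]\<^bsub>shift_group\<^esub> Suc n \<in> P"
    unfolding P_def using assms by (metis (mono_tags, lifting) mem_Collect_eq shift.nat_pow_closed)
  moreover have "u [^]\<^bsub>shift_group\<^esub> Suc n \<in> Q" using \<theta>(3) up assms shift.nat_pow_closed by blast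
  ultimately show False by (simp add: Q_def)
qed

lemma archimedean_shift_group: "archimedean_group shift_group less"
proof -
  have "comm_group shift_group"
    by (rule group.group_comm_groupI[OF shift_group]) (simp add: shift_commute)
  then show ?thesis
  proof (rule archimedean_group.intro, unfold_locales, unfold shift_group_simps)
    show "\<not> a \<lless> a" if "a \<in> K" for a
      using irrefl[OF that] .
    show "a \<lless> c" if "a \<in> K" "b \<in> K" "c \<in> K" "a \<lless> b" "b \<lless> c" for a b c
      using trans[OF that] .
    show "a \<lless> b \<or> a = b \<or> b \<lless> a" if "a \<in> K" "b \<in> K" for a b
      using total[OF that] .
    show "shift c a \<lless> shift c b" if "a \<in> K" "b \<in> K" "c \<in> K" "a \<lless> b" for a b c
      using shift_less[OF that(3,1,2,4)] .
    show "\<exists>n::nat. x \<lless> u [^]\<^bsub>shift_group\<^esub> n" if "u \<in> K" "x \<in> K" "z \<lless> u" for u x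
      using shift_archimedean[OF that] .
  qed
qed

text \<open>Transported to the origin, \<open>[a, b]\<close> ends at a point where \<open>\<phi>\<close> has the value
  \<open>\<phi> b - \<phi> a\<close>. Congruent intervals have the same such end point, and \<open>\<phi>\<close> is injective.\<close>
lemma eqv_iff_additive:
  assumes "archimedean_group.additive shift_group less \<phi>" "a \<in> K" "b \<in> K" "c \<in> K" "d \<in> K"
  shows "eqv a b c d \<longleftrightarrow> \<phi> b - \<phi> a = \<phi> d - \<phi> c"
proof -
  interpret archimedean_group shift_group less by (rule archimedean_shift_group)
  have \<phi>_shift: "\<phi> (shift x y) = \<phi> x + \<phi> y" if "x \<in> K" "y \<in> K" for x y
    using assms(1) that by (simp add: additive_def)
  obtain x where x: "x \<in> K" "eqv a b z x" using transport[of a b z] assms origin by blast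
  obtain y where y: "y \<in> K" "eqv c d z y" using transport[of c d z] assms origin by blast
  have x': "eqv z x a b" and y': "eqv z y c d"
    using x y eqv_sym[of a b z x] eqv_sym[of c d z y] assms origin by auto
  have "shift a x = b" "shift c y = d"
    using x x' y y' shift_eqI[of a x b] shift_eqI[of c y d] assms by auto
  then have diff: "\<phi> b - \<phi> a = \<phi> x" "\<phi> d - \<phi> c = \<phi> y"
    using \<phi>_shift[of a x] \<phi>_shift[of c y] x y assms by auto
  have "eqv a b c d \<longleftrightarrow> x = y"
  proof
    assume "eqv a b c d"
    then have "eqv z x c d" using eqv_trans[of z x a b c d] x x' assms origin by blast
    then have "eqv c d z x" using eqv_sym[of z x c d] x assms origin by blast
    then show "x = y" using transport_unique[of c d z x y] x y assms origin by blast
  next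
    assume "x = y"
    then show "eqv a b c d" using eqv_trans[of a b z x c d] x y y' assms origin by blast
  qed
  then show ?thesis using additive_eq_iff[OF assms(1), of x y] x y diff by simp
qed

end

section \<open>Existence and uniqueness of the interval measure\<close>

context pitch_space
begin

abbreviation (input) cls :: "'a \<Rightarrow> 'a set" where
  "cls \<equiv> pitch_class S lower"

abbreviation (input) pitches :: "'a set set" where
  "pitches \<equiv> S // same_pitch S lower"

text \<open>Transitivity is the separation axiom: if \<open>x\<close> were lower than \<open>z\<close>, both could not have the
  pitch of \<open>y\<close>.\<close>
lemma equiv_same_pitch: "equiv S (same_pitch S lower)"
proof (rule equivI)
  show "same_pitch S lower \<subseteq> S \<times> S" by (auto simp: same_pitch_def)
  show "refl_on S (same_pitch S lower)"
    using lower_irrefl by (auto simp: same_pitch_def refl_on_def)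
  show "sym (same_pitch S lower)" by (auto simp: same_pitch_def sym_def)
  have "(x, z) \<notin> lower"
    if "(x, y) \<in> same_pitch S lower" "(y, z) \<in> same_pitch S lower" for x y z
    using that lower_separates by (auto simp: same_pitch_def)
  then show "trans (same_pitch S lower)"
    unfolding trans_def same_pitch_def by blast
qed

lemma pitches_eq: "pitches = cls ` S"
  by (auto simp: quotient_def pitch_class_def)

lemma cls_eq_iff: "\<lbrakk>x \<in> S; y \<in> S\<rbrakk> \<Longrightarrow> cls x = cls y \<longleftrightarrow> (x, y) \<in> same_pitch S lower"
  unfolding pitch_class_def by (rule eq_equiv_class_iff[OF equiv_same_pitch])

lemma lower_respects:
  assumes "(x, y) \<in> lower" "(x, x') \<in> same_pitch S lower" "(y, y') \<in> same_pitch S lower"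
  shows "(x', y') \<in> lower"
proof -
  have S: "x \<in> S" "y \<in> S" "x' \<in> S" "y' \<in> S" using assms by (auto simp: same_pitch_def)
  have "(y, x') \<notin> lower"
    using transD[OF lower_trans assms(1)] assms(2) by (auto simp: same_pitch_def)
  moreover have "(y, x') \<notin> same_pitch S lower"
    using lower_separates S assms by blast
  ultimately have *: "(x', y) \<in> lower" using S by (auto simp: same_pitch_def)
  have "(y', x') \<notin> lower"
    using transD[OF lower_trans _ *] assms(3) by (auto simp: same_pitch_def)
  moreover have "(x', y') \<notin> same_pitch S lower"
    using lower_separates S assms(3) * by blast
  ultimately show ?thesis using S by (auto simp: same_pitch_def)
qed

definition class_lower :: "'a set \<Rightarrow> 'a set \<Rightarrow> bool" where
  "class_lower A B \<longleftrightarrow> (\<exists>a\<in>A. \<exists>b\<in>B. (a, b) \<in> lower)"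

lemma class_lower_iff:
  assumes "x \<in> S" "y \<in> S"
  shows "class_lower (cls x) (cls y) \<longleftrightarrow> (x, y) \<in> lower"
proof
  assume "class_lower (cls x) (cls y)"
  then obtain x' y' where "(x, x') \<in> same_pitch S lower" "(y, y') \<in> same_pitch S lower" "(x', y') \<in> lower"
    by (auto simp: class_lower_def pitch_class_def)
  then show "(x, y) \<in> lower"
    using lower_respects equiv_same_pitch by (meson equivE symD)
next
  assume "(x, y) \<in> lower"
  then show "class_lower (cls x) (cls y)"
    using assms lower_irrefl unfolding class_lower_def pitch_class_def same_pitch_def by blast
qed

lemma lower_total: "\<lbrakk>x \<in> S; y \<in> S\<rbrakk> \<Longrightarrow> (x, y) \<in> lower \<or> cls x = cls y \<or> (y, x) \<in> lower"
  using cls_eq_iff by (auto simp: same_pitch_def)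

end

context interval_space
begin

lemma pitch_line_pitches:
  assumes "x0 \<in> S"
  shows "pitch_line pitches class_lower (\<lambda>A B C D. ((A, B), (C, D)) \<in> congr) (cls x0)"
proof unfold_locales
  show "cls x0 \<in> pitches" using assms by (simp add: pitches_eq)
next
  fix A assume "A \<in> pitches"
  then obtain a where a: "a \<in> S" "A = cls a" by (auto simp: pitches_eq)
  show "\<not> class_lower A A" using lower_irrefl a by (simp add: class_lower_iff)
  show "\<exists>B\<in>pitches. class_lower A B"
    using lower_unbounded a by (auto simp: pitches_eq class_lower_iff)
next
  fix A B C assume "A \<in> pitches" "B \<in> pitches" "C \<in> pitches" and *: "class_lower A B" "class_lower B C"
  then show "class_lower A C"
    using transD[OF lower_trans] by (auto simp: pitches_eq class_lower_iff)
next
  fix A B assume AB: "A \<in> pitches" "B \<in> pitches"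
  then obtain a b where "a \<in> S" "b \<in> S" "A = cls a" "B = cls b" unfolding pitches_eq by blast
  then show "class_lower A B \<or> A = B \<or> class_lower B A"
    using lower_total[of a b] by (simp add: class_lower_iff)
  show "((A, B), (A, B)) \<in> congr"
    using congr_refl AB by (simp add: intervals_def)
next
  fix A B C D E F
  assume "((A, B), (C, D)) \<in> congr" "((C, D), (E, F)) \<in> congr"
  then show "((A, B), (E, F)) \<in> congr" by (rule transD[OF congr_trans])
next
  fix A B C assume "A \<in> pitches" "B \<in> pitches" "C \<in> pitches"
  then show "\<exists>D\<in>pitches. ((A, B), (C, D)) \<in> congr"
    using congr_transport unfolding interval_def pitches_eq by blast
next
  fix A B C D E
  assume "A \<in> pitches" "B \<in> pitches" "C \<in> pitches" "D \<in> pitches" "E \<in> pitches"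
    and congr: "((A, B), (C, D)) \<in> congr" "((A, B), (C, E)) \<in> congr"
  then obtain a b c d e where S: "a \<in> S" "b \<in> S" "c \<in> S" "d \<in> S" "e \<in> S"
    and eq: "A = cls a" "B = cls b" "C = cls c" "D = cls d" "E = cls e"
    unfolding pitches_eq by blast
  obtain f where "f \<in> S" and f: "\<And>b'. b' \<in> S \<Longrightarrow> ((A, B), (C, cls b')) \<in> congr \<Longrightarrow> cls f = cls b'"
    using congr_transport[unfolded interval_def, rule_format, OF S(1-3)] eq cls_eq_iff by metis
  then show "D = E" using S congr eq by metis
next
  fix A B C D
  assume K: "A \<in> pitches" "B \<in> pitches" "C \<in> pitches" "D \<in> pitches" and less: "class_lower A B"
  then obtain a b c d where S: "a \<in> S" "b \<in> S" "c \<in> S" "d \<in> S"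
    and eq: "A = cls a" "B = cls b" "C = cls c" "D = cls d"
    unfolding pitches_eq by blast
  show "((A, B), (C, D)) \<in> congr \<longleftrightarrow> ((B, A), (D, C)) \<in> congr"
    using congr_inverse[unfolded interval_def, rule_format, OF S] less S eq class_lower_iff by simp
  show "class_lower C D" if "((A, B), (C, D)) \<in> congr"
    using congr_lower[unfolded interval_def, rule_format, OF S] that less S eq class_lower_iff by simp
next
  fix A B C A' B' C'
  assume K: "A \<in> pitches" "B \<in> pitches" "C \<in> pitches" "A' \<in> pitches" "B' \<in> pitches" "C' \<in> pitches"
    and less: "class_lower A B" "class_lower B C"
  then obtain a b c a' b' c' where S: "a \<in> S" "b \<in> S" "c \<in> S" "a' \<in> S" "b' \<in> S" "c' \<in> S"
    and eq: "A = cls a" "B = cls b" "C = cls c" "A' = cls a'" "B' = cls b'" "C' = cls c'"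
    unfolding pitches_eq by blast
  show "((A, C), (A', C')) \<in> congr" if "((A, B), (A', B')) \<in> congr" "((B, C), (B', C')) \<in> congr"
    using congr_compose[unfolded interval_def, rule_format, OF S] that less S eq class_lower_iff by simp
  show "((A, C), (C', A')) \<in> congr" if "((A, B), (B', A')) \<in> congr" "((B, C), (C', B')) \<in> congr"
    using congr_compose_inverse[unfolded interval_def, rule_format, OF S] that less S eq class_lower_iff by simp
next
  fix P Q
  assume PQ: "P \<union> Q = pitches" "P \<inter> Q = {}" "P \<noteq> {}" "Q \<noteq> {}"
    and below: "\<forall>q\<in>Q. \<forall>p\<in>P. \<not> class_lower q p"
  define P' Q' where "P' = {s\<in>S. cls s \<in> P}" and "Q' = {s\<in>S. cls s \<in> Q}"
  have sub: "P \<subseteq> cls ` S" "Q \<subseteq> cls ` S" using PQ(1) unfolding pitches_eq by auto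
  have "P' \<union> Q' = S"
    using PQ(1) unfolding pitches_eq P'_def Q'_def by blast
  moreover have "P' \<inter> Q' = {}" using PQ(2) by (auto simp: P'_def Q'_def)
  moreover have "P' \<noteq> {}" "Q' \<noteq> {}" using PQ(3,4) sub by (auto simp: P'_def Q'_def)
  moreover have "\<forall>q\<in>Q'. \<forall>p\<in>P'. (q, p) \<notin> lower"
    using below class_lower_iff unfolding P'_def Q'_def by blast
  ultimately obtain \<theta> where \<theta>: "\<theta> \<in> S" "\<forall>s\<in>S. (s, \<theta>) \<in> lower \<longrightarrow> s \<in> P'"
      "\<forall>s\<in>S. (\<theta>, s) \<in> lower \<longrightarrow> s \<in> Q'"
    using dedekind[rule_format, of P' Q'] by blast
  then show "\<exists>\<theta>\<in>pitches. (\<forall>s\<in>pitches. class_lower s \<theta> \<longrightarrow> s \<in> P) \<and>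
      (\<forall>s\<in>pitches. class_lower \<theta> s \<longrightarrow> s \<in> Q)"
    by (intro bexI[of _ "cls \<theta>"]) (auto simp: pitches_eq class_lower_iff P'_def Q'_def)
qed

lemma is_measure_pitches:
  assumes "x0 \<in> S" "y0 \<in> S"
  shows "is_measure S lower congr x0 y0 lam m \<longleftrightarrow>
     m \<in> pitches \<times> pitches \<rightarrow>\<^sub>E {0<..} \<and> m (cls x0, cls y0) = lam \<and>
     (\<forall>A\<in>pitches. \<forall>B\<in>pitches. (m (A, B) > 1 \<longleftrightarrow> class_lower A B) \<and>
        (m (A, B) = 1 \<longleftrightarrow> A = B) \<and> (m (A, B) < 1 \<longleftrightarrow> class_lower B A)) \<and>
     (\<forall>A\<in>pitches. \<forall>B\<in>pitches. \<forall>C\<in>pitches. \<forall>D\<in>pitches.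
        m (A, B) = m (C, D) \<longleftrightarrow> ((A, B), (C, D)) \<in> congr) \<and>
     (\<forall>A\<in>pitches. \<forall>B\<in>pitches. \<forall>C\<in>pitches. m (A, C) = m (A, B) * m (B, C))"
  unfolding is_measure_def intervals_def interval_def
  by (simp add: pitches_eq class_lower_iff cls_eq_iff cong: conj_cong ball_cong)

text \<open>Measures and order-preserving homomorphisms normalised at \<open>u\<close> determine each other:
  exponentiating differences of \<open>\<phi>\<close> gives a measure, and the logarithm of a measure, read along
  intervals from the origin, is a homomorphism because \<open>[z, B]\<close> is congruent to
  \<open>[A, shift A B]\<close>.\<close>
theorem measure_exists_unique:
  assumes ref: "x0 \<in> S" "y0 \<in> S" "(x0, y0) \<in> lower" and "lam > 1"
  shows "\<exists>!m. is_measure S lower congr x0 y0 lam m"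
proof -
  interpret line: pitch_line pitches class_lower "\<lambda>A B C D. ((A, B), (C, D)) \<in> congr" "cls x0"
    using pitch_line_pitches[OF ref(1)] .
  interpret archimedean_group line.shift_group class_lower
    by (rule line.archimedean_shift_group)
  define z u where "z = cls x0" and "u = cls y0"
  have K: "z \<in> pitches" "u \<in> pitches" "class_lower z u"
    using ref by (simp_all add: z_def u_def pitches_eq class_lower_iff)
  obtain \<phi> where \<phi>: "additive \<phi>" "\<phi> u = 1"
    using additive_exists[of u] K by (auto simp: z_def)
  have \<phi>z: "\<phi> z = 0" using additive_one[OF \<phi>(1)] by (simp add: z_def)
  have \<phi>_less: "\<phi> A < \<phi> B \<longleftrightarrow> class_lower A B" if "A \<in> pitches" "B \<in> pitches" for A B
    using additive_less_iff[OF \<phi>(1)] that by simp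
  have \<phi>_eq: "\<phi> A = \<phi> B \<longleftrightarrow> A = B" if "A \<in> pitches" "B \<in> pitches" for A B
    using additive_eq_iff[OF \<phi>(1)] that by simp
  define \<mu> where "\<mu> = restrict (\<lambda>(A, B). lam powr (\<phi> B - \<phi> A)) (pitches \<times> pitches)"
  have \<mu>: "\<mu> (A, B) = lam powr (\<phi> B - \<phi> A)" if "A \<in> pitches" "B \<in> pitches" for A B
    using that by (simp add: \<mu>_def)
  have "is_measure S lower congr x0 y0 lam \<mu>"
    unfolding is_measure_pitches[OF ref(1,2)]
  proof (intro conjI ballI)
    show "\<mu> \<in> pitches \<times> pitches \<rightarrow>\<^sub>E {0<..}" using \<open>lam > 1\<close> by (auto simp: \<mu>_def)
    show "\<mu> (cls x0, cls y0) = lam"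
      using \<mu>[OF K(1,2)] \<phi>(2) \<phi>z \<open>lam > 1\<close> by (simp add: z_def u_def)
    fix A B assume AB: "A \<in> pitches" "B \<in> pitches"
    show "\<mu> (A, B) > 1 \<longleftrightarrow> class_lower A B"
      using powr_less_cancel_iff[OF \<open>lam > 1\<close>, of 0 "\<phi> B - \<phi> A"] \<open>lam > 1\<close> AB \<phi>_less by (simp add: \<mu>)
    show "\<mu> (A, B) < 1 \<longleftrightarrow> class_lower B A"
      using powr_less_cancel_iff[OF \<open>lam > 1\<close>, of "\<phi> B - \<phi> A" 0] \<open>lam > 1\<close> AB \<phi>_less by (simp add: \<mu>)
    show "\<mu> (A, B) = 1 \<longleftrightarrow> A = B"
      using powr_inj[of lam "\<phi> B - \<phi> A" 0] \<open>lam > 1\<close> AB \<phi>_eq[of B A] by (auto simp: \<mu>)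
    fix C assume C: "C \<in> pitches"
    show "\<mu> (A, C) = \<mu> (A, B) * \<mu> (B, C)"
      using AB C \<open>lam > 1\<close> by (simp add: \<mu> flip: powr_add)
    fix D assume D: "D \<in> pitches"
    show "\<mu> (A, B) = \<mu> (C, D) \<longleftrightarrow> ((A, B), (C, D)) \<in> congr"
      using AB C D \<open>lam > 1\<close> line.eqv_iff_additive[OF \<phi>(1) AB C D] by (simp add: \<mu> powr_inj)
  qed
  moreover have "m = \<mu>" if "is_measure S lower congr x0 y0 lam m" for m
  proof -
    note m = that[unfolded is_measure_pitches[OF ref(1,2)], folded z_def u_def]
    note m_PiE = m[THEN conjunct1] and m_ref = m[THEN conjunct2, THEN conjunct1]
      and m_less = m[THEN conjunct2, THEN conjunct2, THEN conjunct1, rule_format]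
      and m_congr = m[THEN conjunct2, THEN conjunct2, THEN conjunct2, THEN conjunct1, rule_format]
      and mult = m[THEN conjunct2, THEN conjunct2, THEN conjunct2, THEN conjunct2, rule_format]
    have pos: "m (A, B) > 0" if "A \<in> pitches" "B \<in> pitches" for A B
      using PiE_mem[OF m_PiE, of "(A, B)"] that by simp
    define \<psi> where "\<psi> A = ln (m (z, A)) / ln lam" for A
    have ln: "ln lam > 0" using \<open>lam > 1\<close> by simp
    have "additive \<psi>"
      unfolding additive_def line.shift_group_simps
    proof (intro conjI ballI impI)
      fix A B assume AB: "A \<in> pitches" "B \<in> pitches"
      define C where "C = line.shift A B"
      have C: "C \<in> pitches" "((z, B), (A, C)) \<in> congr"
        using line.shift[OF AB] by (simp_all add: C_def z_def)
      then have "m (z, B) = m (A, C)" using m_congr[of z B A C] AB K by simp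
      then have "m (z, C) = m (z, A) * m (z, B)" using mult[of z A C] AB C K by simp
      then show "\<psi> (line.shift A B) = \<psi> A + \<psi> B"
        using pos[of z A] pos[of z B] AB K
        by (simp add: \<psi>_def ln_mult add_divide_distrib flip: C_def)
      assume "class_lower A B"
      then have "m (A, B) > 1" using m_less[OF AB] by simp
      then have "m (z, A) < m (z, B)" using mult[of z A B] pos[of z A] AB K by simp
      then show "\<psi> A < \<psi> B"
        using pos[of z A] pos[of z B] AB K ln by (simp add: \<psi>_def divide_strict_right_mono)
    qed
    moreover have "\<psi> u = 1" using m_ref ln by (simp add: \<psi>_def)
    ultimately have \<psi>\<phi>: "\<psi> A = \<phi> A" if "A \<in> pitches" for A
      using additive_unique[of \<psi> \<phi> u A] \<phi> K that by (simp add: z_def)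
    have mz: "m (z, A) = lam powr \<phi> A" if "A \<in> pitches" for A
    proof -
      have "ln (m (z, A)) = \<phi> A * ln lam"
        using that \<psi>\<phi>[of A] ln by (simp add: \<psi>_def field_simps)
      then have "exp (\<phi> A * ln lam) = m (z, A)" using exp_ln[OF pos[OF K(1) that]] by simp
      then show ?thesis using \<open>lam > 1\<close> by (simp add: powr_def)
    qed
    have "m (A, B) = \<mu> (A, B)" if "A \<in> pitches" "B \<in> pitches" for A B
      using mult[of z A B] mz that K \<open>lam > 1\<close> by (simp add: \<mu> powr_diff)
    then show "m = \<mu>"
      using m_PiE by (intro extensionalityI[of _ "pitches \<times> pitches"]) (auto simp: \<mu>_def PiE_iff)
  qed
  ultimately show ?thesis by blast
qed

end

section \<open>Isomorphism of any two models\<close>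

context PI_model
begin

lemma is_measure_interval_measure:
  "is_measure S lower congr x0 y0 lam (interval_measure S lower congr x0 y0 lam)"
  unfolding interval_measure_def
  using measure_exists_unique[OF reference_sounds constants(1)] by (rule theI')

abbreviation (input) freq :: "'a \<Rightarrow> real" where
  "freq \<equiv> frequency S lower congr x0 y0 lam f0"

text \<open>The measure of \<open>[a, b]\<close> is the quotient of the frequencies, so the properties of the measure
  become a description of both undefined concepts by frequency.\<close>
lemma frequency:
  shows frequency_pos: "a \<in> S \<Longrightarrow> freq a > 0"
    and frequency_less: "\<lbrakk>a \<in> S; b \<in> S\<rbrakk> \<Longrightarrow> (a, b) \<in> lower \<longleftrightarrow> freq a < freq b"
    and frequency_ratio: "\<lbrakk>a \<in> S; b \<in> S; c \<in> S; d \<in> S\<rbrakk> \<Longrightarrow>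
      (interval S lower a b, interval S lower c d) \<in> congr \<longleftrightarrow> freq b / freq a = freq d / freq c"
proof -
  define m where "m a b = interval_measure S lower congr x0 y0 lam (interval S lower a b)" for a b
  note meas = is_measure_interval_measure[unfolded is_measure_def, folded m_def]
  have pos: "m a b > 0" if "a \<in> S" "b \<in> S" for a b
    unfolding m_def using that
    by (intro PiE_mem[OF meas[THEN conjunct1], simplified]) (auto simp: interval_def intervals_def pitches_eq)
  have mult: "m a c = m a b * m b c" if "a \<in> S" "b \<in> S" "c \<in> S" for a b c
    using meas that by blast
  have f: "freq a = f0 * m x0 a" for a by (simp add: frequency_def m_def)
  have m: "m a b = freq b / freq a" if "a \<in> S" "b \<in> S" for a b
    using mult[of x0 a b] pos[of x0 a] that reference_sounds constants by (simp add: f)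
  show fpos: "freq a > 0" if "a \<in> S" for a
    using pos[of x0 a] that reference_sounds constants by (simp add: f)
  show "(a, b) \<in> lower \<longleftrightarrow> freq a < freq b" if "a \<in> S" "b \<in> S"
  proof -
    have "(a, b) \<in> lower \<longleftrightarrow> m a b > 1" using meas that by blast
    then show ?thesis using fpos that by (simp add: m)
  qed
  show "(interval S lower a b, interval S lower c d) \<in> congr \<longleftrightarrow> freq b / freq a = freq d / freq c"
    if "a \<in> S" "b \<in> S" "c \<in> S" "d \<in> S"
  proof -
    have "(interval S lower a b, interval S lower c d) \<in> congr \<longleftrightarrow> m a b = m c d"
      using meas that by blast
    then show ?thesis using that by (simp add: m)
  qed
qed

lemma timbre_coordinate:
  obtains \<Gamma> where "bij_betw \<Gamma> S Cp" "\<And>x. x \<in> S \<Longrightarrow> least_period (\<Gamma> x) = freq x"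
proof -
  obtain \<iota> \<Gamma> where "is_timbre S freq \<iota> \<Gamma>" "\<forall>x\<in>S. \<forall>y\<in>S. \<Gamma> x = \<Gamma> y \<longrightarrow> x = y"
    using loudness_and_colour by blast
  then show thesis
    by (intro that[of \<Gamma>]) (auto simp: is_timbre_def bij_betw_def inj_on_def)
qed

end

text \<open>Sounds of equal timbre have equal frequency, because the frequency is the least period of the
  timbre.\<close>
theorem PI_model_isomorphic:
  assumes "PI_model lam f0 i0 S1 lower1 congr1 x1 y1" and "PI_model lam f0 i0 S2 lower2 congr2 x2 y2"
  shows "\<exists>h. is_isomorphism S1 lower1 congr1 S2 lower2 congr2 h"
proof -
  interpret M1: PI_model lam f0 i0 S1 lower1 congr1 x1 y1 by fact
  interpret M2: PI_model lam f0 i0 S2 lower2 congr2 x2 y2 by fact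
  obtain \<Gamma>1 where \<Gamma>1: "bij_betw \<Gamma>1 S1 Cp" "\<And>x. x \<in> S1 \<Longrightarrow> least_period (\<Gamma>1 x) = M1.freq x"
    using M1.timbre_coordinate by blast
  obtain \<Gamma>2 where \<Gamma>2: "bij_betw \<Gamma>2 S2 Cp" "\<And>x. x \<in> S2 \<Longrightarrow> least_period (\<Gamma>2 x) = M2.freq x"
    using M2.timbre_coordinate by blast
  define h where "h = inv_into S2 \<Gamma>2 \<circ> \<Gamma>1"
  have h: "bij_betw h S1 S2"
    unfolding h_def using \<Gamma>1(1) bij_betw_inv_into[OF \<Gamma>2(1)] by (rule bij_betw_trans)
  have hS: "h x \<in> S2" if "x \<in> S1" for x using bij_betwE[OF h] that by blast
  have "\<Gamma>2 (h x) = \<Gamma>1 x" if "x \<in> S1" for x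
    using bij_betw_inv_into_right[OF \<Gamma>2(1)] bij_betwE[OF \<Gamma>1(1)] that by (simp add: h_def)
  then have freq: "M2.freq (h x) = M1.freq x" if "x \<in> S1" for x
    using \<Gamma>1(2) \<Gamma>2(2) hS that by metis
  have "is_isomorphism S1 lower1 congr1 S2 lower2 congr2 h"
    unfolding is_isomorphism_def
    using h hS by (simp add: freq M1.frequency_less M2.frequency_less
        M1.frequency_ratio M2.frequency_ratio)
  then show ?thesis by blast
qed

section \<open>Least period and amplitude of continuous periodic functions\<close>

text \<open>If the infimum of the positive periods is not a period, there are two distinct periods
  arbitrarily close to it, hence arbitrarily small positive periods (their differences). Every
  point can then be moved by a period arbitrarily close to \<open>0\<close>, and continuity at \<open>0\<close> makes
  the function constant.\<close>
lemma Cp_least_period: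
  assumes "g \<in> Cp"
  shows "least_period g > 0" and "g (t + least_period g) = g t"
    and "\<And>T. T > 0 \<Longrightarrow> (\<And>t. g (t + T) = g t) \<Longrightarrow> least_period g \<le> T"
proof -
  define P where "P = {T. 0 < T \<and> (\<forall>t. g (t + T) = g t)}"
  define L where "L = Inf P"
  have cont: "continuous_on UNIV g" and nonconst: "\<not> g constant_on UNIV" and "P \<noteq> {}"
    using assms by (auto simp: Cp_def P_def)
  have bdd: "bdd_below P" by (rule bdd_belowI[of _ 0]) (auto simp: P_def)
  have "L \<in> P"
  proof (rule ccontr)
    assume "L \<notin> P"
    have small: "\<exists>p\<in>P. p < \<delta>" if "\<delta> > 0" for \<delta>
    proof -
      obtain p2 where p2: "p2 \<in> P" "p2 < L + \<delta>"
        using cInf_lessD[OF \<open>P \<noteq> {}\<close>, of "L + \<delta>"] \<open>\<delta> > 0\<close> by (auto simp: L_def)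
      have "L \<noteq> p2" using \<open>L \<notin> P\<close> p2(1) by blast
      then have "L < p2" using cInf_lower[OF p2(1) bdd] by (simp add: L_def)
      then obtain p1 where p1: "p1 \<in> P" "p1 < p2"
        using cInf_lessD[OF \<open>P \<noteq> {}\<close>, of p2] by (auto simp: L_def)
      have "L \<le> p1" using cInf_lower[OF p1(1) bdd] by (simp add: L_def)
      have per: "g (s + p1) = g s" for s using p1(1) by (simp add: P_def)
      have "g (t + (p2 - p1)) = g t" for t
      proof -
        have "g (t + (p2 - p1)) = g (t + (p2 - p1) + p1)" by (rule per[symmetric])
        also have "\<dots> = g (t + p2)" by (simp add: algebra_simps)
        also have "\<dots> = g t" using p2 by (simp add: P_def)
        finally show ?thesis .
      qed
      then have "p2 - p1 \<in> P" using p1 by (simp add: P_def)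
      then show ?thesis using p2 \<open>L \<le> p1\<close> by (intro bexI[of _ "p2 - p1"]) auto
    qed
    have "g x = g 0" for x
    proof (rule ccontr)
      assume "g x \<noteq> g 0"
      then obtain \<delta> where \<delta>: "\<delta> > 0" "\<And>y. dist y 0 < \<delta> \<Longrightarrow> dist (g y) (g 0) < dist (g x) (g 0)"
        using cont unfolding continuous_on_iff
        by (metis UNIV_I zero_less_dist_iff)
      obtain p where p: "p \<in> P" "p < \<delta>" using small[OF \<delta>(1)] by blast
      have "p > 0" using p by (simp add: P_def)
      have nat: "g (t + real n * p) = g t" for t n
      proof (induction n)
        case (Suc n)
        have "g (t + real (Suc n) * p) = g ((t + real n * p) + p)" by (simp add: algebra_simps)
        then show ?case using Suc p by (simp add: P_def)
      qed simp
      have int: "g (t + of_int k * p) = g t" for t k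
      proof (cases "k \<ge> 0")
        case True
        then show ?thesis using nat[of t "nat k"] by simp
      next
        case False
        then show ?thesis using nat[of "t + of_int k * p" "nat (- k)"] by simp
      qed
      define y where "y = x - \<lfloor>x / p\<rfloor> * p"
      have "g y = g x" using int[of y "\<lfloor>x / p\<rfloor>"] by (simp add: y_def)
      moreover have "0 \<le> y" "y < p"
        using floor_divide_lower[OF \<open>p > 0\<close>, of x] floor_divide_upper[OF \<open>p > 0\<close>, of x]
        by (auto simp: y_def algebra_simps)
      ultimately show False using \<delta>(2)[of y] p by (simp add: dist_real_def)
    qed
    then have "g constant_on UNIV" by (auto simp: constant_on_def)
    then show False using nonconst by simp
  qed
  then have "least_period g = L"
    unfolding least_period_def
    using cInf_lower[OF _ bdd] by (intro Least_equality) (auto simp: P_def L_def)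
  then show "least_period g > 0" "g (t + least_period g) = g t"
    "\<And>T. T > 0 \<Longrightarrow> (\<And>t. g (t + T) = g t) \<Longrightarrow> least_period g \<le> T"
    using \<open>L \<in> P\<close> cInf_lower[OF _ bdd] by (auto simp: P_def L_def)
qed

text \<open>The range is the image of one period, hence compact, so the extrema in the definition of the
  amplitude are attained.\<close>
lemma Cp_amplitude_pos:
  assumes "g \<in> Cp"
  shows "amplitude g > 0"
proof -
  obtain T where T: "T > 0" "\<And>t. g (t + T) = g t" and cont: "continuous_on UNIV g"
    and nonconst: "\<not> g constant_on UNIV" using assms by (auto simp: Cp_def)
  have int: "g (t + of_int k * T) = g t" for t k
  proof (induction k rule: int_induct[where k = 0])
    case (step1 i)
    have "g (t + of_int (i + 1) * T) = g ((t + of_int i * T) + T)" by (simp add: algebra_simps)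
    then show ?case using step1 T by simp
  next
    case (step2 i)
    have "g (t + of_int (i - 1) * T) = g ((t + of_int (i - 1) * T) + T)" using T by simp
    also have "\<dots> = g (t + of_int i * T)" by (simp add: algebra_simps)
    finally show ?case using step2 by simp
  qed simp
  have range: "range g = g ` {0..T}"
  proof -
    have "g x \<in> g ` {0..T}" for x
    proof (rule image_eqI)
      show "g x = g (x - \<lfloor>x / T\<rfloor> * T)" using int[of "x - \<lfloor>x / T\<rfloor> * T" "\<lfloor>x / T\<rfloor>"] by simp
      show "x - \<lfloor>x / T\<rfloor> * T \<in> {0..T}"
        using floor_divide_lower[OF T(1), of x] floor_divide_upper[OF T(1), of x]
        by (auto simp: algebra_simps)
    qed
    then show ?thesis by auto
  qed
  have cmp: "compact (range g)"
    unfolding range by (intro compact_continuous_image continuous_on_subset[OF cont]) auto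
  obtain M where M: "M \<in> range g" "\<And>y. y \<in> range g \<Longrightarrow> y \<le> M"
    using compact_attains_sup[OF cmp] by auto
  obtain m where m: "m \<in> range g" "\<And>y. y \<in> range g \<Longrightarrow> m \<le> y"
    using compact_attains_inf[OF cmp] by auto
  have "amplitude g = M - m"
    unfolding amplitude_def using M m Greatest_equality[of "\<lambda>r. r \<in> range g" M]
      Least_equality[of "\<lambda>r. r \<in> range g" m] by simp
  moreover have "m < M"
  proof (rule ccontr)
    assume "\<not> m < M"
    then have "g x = M" for x using M(2)[of "g x"] m(2)[of "g x"] by simp
    then show False using nonconst by (auto simp: constant_on_def)
  qed
  ultimately show ?thesis by simp
qed

lemma Cp_cosine:
  assumes "T > 0" "r > 0"
  obtains g where "g \<in> Cp" "least_period g = T" "amplitude g = r"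
proof -
  define g where "g t = r / 2 * cos (2 * pi * t / T)" for t
  have per: "g (t + T) = g t" for t
    using assms cos_periodic[of "2 * pi * t / T"] by (simp add: g_def field_simps)
  have half: "g (T / 2) = - (r / 2)" "g 0 = r / 2" using assms by (simp_all add: g_def)
  have "g \<in> Cp"
    unfolding Cp_def
  proof (intro CollectI conjI)
    show "continuous_on UNIV g" unfolding g_def by (intro continuous_intros) (use assms in auto)
    show "\<not> g constant_on UNIV" using half assms unfolding constant_on_def
      by (metis UNIV_I add.inverse_neutral half_gt_zero less_irrefl neg_less_0_iff_less order_less_trans)
    show "\<exists>T>0. \<forall>t. g (t + T) = g t" using per assms by blast
  qed
  moreover have "least_period g = T"
    unfolding least_period_def
  proof (rule Least_equality)
    fix U assume U: "0 < U \<and> (\<forall>t. g (t + U) = g t)"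
    then have "g (0 + U) = g 0" by blast
    then have "cos (2 * pi * U / T) = 1" using assms by (simp add: g_def)
    then obtain n :: int where "2 * pi * U / T = of_int n * 2 * pi"
      using cos_one_2pi_int by blast
    then have n: "U = of_int n * T" using assms by (simp add: field_simps)
    then have "n \<ge> 1" using U assms by (simp add: zero_less_mult_iff)
    then show "T \<le> U" using n assms by simp
  qed (use per assms in auto)
  moreover have "amplitude g = r"
  proof -
    have "(GREATEST y. y \<in> range g) = r / 2"
      using half(2) assms by (intro Greatest_equality) (auto simp: g_def image_iff mult_left_le intro: exI[of _ 0])
    moreover have "(LEAST y. y \<in> range g) = - (r / 2)"
    proof (rule Least_equality)
      show "- (r / 2) \<in> range g" using half(1) by (metis rangeI)
      fix y assume "y \<in> range g"
      then obtain t where "y = r / 2 * cos (2 * pi * t / T)" unfolding g_def by blast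
      then show "- (r / 2) \<le> y"
        using mult_left_mono[OF cos_ge_minus_one[of "2 * pi * t / T"], of "r / 2"] assms by simp
    qed
    ultimately show ?thesis by (simp add: amplitude_def)
  qed
  ultimately show thesis by (rule that)
qed

section \<open>A model on the continuous periodic functions\<close>

definition value_lower :: "'a set \<Rightarrow> ('a \<Rightarrow> real) \<Rightarrow> ('a \<times> 'a) set" where
  "value_lower S T = {(x, y). x \<in> S \<and> y \<in> S \<and> T x < T y}"

text \<open>The common value of \<open>T\<close> on a pitch class, for classes on which \<open>T\<close> is constant.\<close>
definition class_value :: "('a \<Rightarrow> real) \<Rightarrow> 'a set \<Rightarrow> real" where
  "class_value T A = the_elem (T ` A)"

definition value_congr :: "'a set \<Rightarrow> ('a \<Rightarrow> real) \<Rightarrow> (('a set \<times> 'a set) \<times> ('a set \<times> 'a set)) set" where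
  "value_congr S T = {(i, j). i \<in> intervals S (value_lower S T) \<and> j \<in> intervals S (value_lower S T) \<and>
     class_value T (snd i) / class_value T (fst i) = class_value T (snd j) / class_value T (fst j)}"

lemma value_lower_iff: "\<lbrakk>x \<in> S; y \<in> S\<rbrakk> \<Longrightarrow> (x, y) \<in> value_lower S T \<longleftrightarrow> T x < T y"
  by (simp add: value_lower_def)

lemma value_same_pitch_iff:
  "(x, y) \<in> same_pitch S (value_lower S T) \<longleftrightarrow> x \<in> S \<and> y \<in> S \<and> T x = T y"
  by (auto simp: same_pitch_def value_lower_def)

lemma class_value:
  assumes "x \<in> S"
  shows "class_value T (pitch_class S (value_lower S T) x) = T x"
proof -
  have "T ` pitch_class S (value_lower S T) x = {T x}"
    using assms by (auto simp: pitch_class_def value_same_pitch_iff Image_def)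
  then show ?thesis by (simp add: class_value_def)
qed

lemma value_congr_iff:
  assumes "a \<in> S" "b \<in> S" "c \<in> S" "d \<in> S"
  shows "(interval S (value_lower S T) a b, interval S (value_lower S T) c d) \<in> value_congr S T \<longleftrightarrow>
    T b / T a = T d / T c"
proof -
  have "pitch_class S (value_lower S T) x \<in> S // same_pitch S (value_lower S T)" if "x \<in> S" for x
    using that by (auto simp: pitch_class_def quotient_def)
  then show ?thesis
    using assms by (simp add: value_congr_def interval_def intervals_def class_value)
qed

text \<open>Any set mapped onto the positive reals carries the structure of an interval space pulled back
  along the map. The map is far from injective in the application: sounds of equal pitch may
  differ in loudness and colour.\<close>
locale frequency_coordinate =
  fixes S :: "'a set" and T :: "'a \<Rightarrow> real"
  assumes onto: "T ` S = {0<..}"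
begin

lemma T_pos: "x \<in> S \<Longrightarrow> T x > 0" using onto by auto

lemma T_surj: "r > 0 \<Longrightarrow> \<exists>x\<in>S. T x = r" using onto by (metis greaterThan_iff imageE)

abbreviation (input) lo :: "'a \<Rightarrow> 'a \<Rightarrow> bool" (infix "\<lhd>" 50) where
  "x \<lhd> y \<equiv> (x, y) \<in> value_lower S T"

abbreviation (input) congruent :: "'a \<Rightarrow> 'a \<Rightarrow> 'a \<Rightarrow> 'a \<Rightarrow> bool" where
  "congruent a b c d \<equiv>
     (interval S (value_lower S T) a b, interval S (value_lower S T) c d) \<in> value_congr S T"

sublocale pitch_space S "value_lower S T"
proof unfold_locales
  show "value_lower S T \<subseteq> S \<times> S" by (auto simp: value_lower_def)
  show "\<forall>x\<in>S. \<not> x \<lhd> x" by (simp add: value_lower_def)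
  show "trans (value_lower S T)" by (auto simp: trans_def value_lower_def)
  obtain x y where "x \<in> S" "T x = 1" "y \<in> S" "T y = 2" using T_surj[of 1] T_surj[of 2] by auto
  then show "\<exists>x\<in>S. \<exists>y\<in>S. x \<lhd> y \<or> y \<lhd> x"
    by (intro bexI[of _ x] bexI[of _ y]) (auto simp: value_lower_def)
  show "\<forall>x\<in>S. \<forall>y\<in>S. x \<lhd> y \<longrightarrow>
      \<not> (\<exists>z\<in>S. (x, z) \<in> same_pitch S (value_lower S T) \<and> (y, z) \<in> same_pitch S (value_lower S T))"
    by (auto simp: value_same_pitch_iff) (auto simp: value_lower_def)
  show "\<forall>x\<in>S. \<exists>a\<in>S. \<exists>b\<in>S. a \<lhd> x \<and> x \<lhd> b"
  proof
    fix x assume x: "x \<in> S"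
    obtain a where "a \<in> S" "T a = T x / 2" using T_surj[of "T x / 2"] T_pos[OF x] by auto
    moreover obtain b where "b \<in> S" "T b = 2 * T x" using T_surj[of "2 * T x"] T_pos[OF x] by auto
    ultimately show "\<exists>a\<in>S. \<exists>b\<in>S. a \<lhd> x \<and> x \<lhd> b"
      using T_pos[OF x] x by (intro bexI[of _ a] bexI[of _ b]) (auto simp: value_lower_iff)
  qed
  show "\<forall>x\<in>S. \<forall>y\<in>S. x \<lhd> y \<longrightarrow> (\<exists>a\<in>S. x \<lhd> a \<and> a \<lhd> y)"
  proof (intro ballI impI)
    fix x y assume xy: "x \<in> S" "y \<in> S" "x \<lhd> y"
    obtain a where "a \<in> S" "T a = (T x + T y) / 2"
      using T_surj[of "(T x + T y) / 2"] T_pos[OF xy(1)] T_pos[OF xy(2)] by auto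
    then show "\<exists>a\<in>S. x \<lhd> a \<and> a \<lhd> y"
      using xy by (intro bexI[of _ a]) (auto simp: value_lower_iff)
  qed
qed

sublocale interval_space S "value_lower S T" "value_congr S T"
proof unfold_locales
  show "value_congr S T \<subseteq> intervals S (value_lower S T) \<times> intervals S (value_lower S T)"
    by (auto simp: value_congr_def)
  show "\<forall>i\<in>intervals S (value_lower S T). (i, i) \<in> value_congr S T"
    by (simp add: value_congr_def)
  show "trans (value_congr S T)" by (auto simp: trans_def value_congr_def)
  show "\<forall>x\<in>S. \<forall>y\<in>S. \<forall>a\<in>S. \<exists>b\<in>S. congruent x y a b \<and>
      (\<forall>b'\<in>S. congruent x y a b' \<longrightarrow> (b, b') \<in> same_pitch S (value_lower S T))"
  proof (intro ballI)
    fix x y a assume xya: "x \<in> S" "y \<in> S" "a \<in> S"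
    note pos = T_pos[OF xya(1)] T_pos[OF xya(2)] T_pos[OF xya(3)]
    obtain b where b: "b \<in> S" "T b = T a * T y / T x" using T_surj[of "T a * T y / T x"] pos by auto
    show "\<exists>b\<in>S. congruent x y a b \<and>
      (\<forall>b'\<in>S. congruent x y a b' \<longrightarrow> (b, b') \<in> same_pitch S (value_lower S T))"
      using b xya pos
      by (intro bexI[of _ b]) (auto simp: value_congr_iff value_same_pitch_iff field_simps)
  qed
next
  show "\<forall>a\<in>S. \<forall>b\<in>S. \<forall>c\<in>S. \<forall>d\<in>S. a \<lhd> b \<longrightarrow> congruent a b c d \<longrightarrow> c \<lhd> d"
  proof (intro ballI impI)
    fix a b c d assume S: "a \<in> S" "b \<in> S" "c \<in> S" "d \<in> S" and less: "a \<lhd> b"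
      and "congruent a b c d"
    then have "T b / T a = T d / T c" by (simp add: value_congr_iff)
    moreover have "T b / T a > 1" using less S T_pos by (simp add: value_lower_iff)
    ultimately have "T d / T c > 1" by simp
    then show "c \<lhd> d" using S T_pos by (simp add: value_lower_iff)
  qed
  show "\<forall>a\<in>S. \<forall>b\<in>S. \<forall>c\<in>S. \<forall>d\<in>S. a \<lhd> b \<longrightarrow> (congruent a b c d \<longleftrightarrow> congruent b a d c)"
    using T_pos by (auto simp: value_congr_iff frac_eq_eq less_imp_neq[THEN not_sym] mult.commute)
  have compose: "congruent a c a' c'"
    if S: "a \<in> S" "b \<in> S" "c \<in> S" "a' \<in> S" "b' \<in> S" "c' \<in> S"
      and congr: "congruent a b a' b'" "congruent b c b' c'"
    for a b c a' b' c'
  proof -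
    have "T c / T a = (T b / T a) * (T c / T b)" using S T_pos[of b] by simp
    also have "\<dots> = (T b' / T a') * (T c' / T b')" using congr S by (simp add: value_congr_iff)
    also have "\<dots> = T c' / T a'" using S T_pos[of b'] by simp
    finally show ?thesis using S by (simp add: value_congr_iff)
  qed
  then show "\<forall>a\<in>S. \<forall>b\<in>S. \<forall>c\<in>S. \<forall>a'\<in>S. \<forall>b'\<in>S. \<forall>c'\<in>S.
      a \<lhd> b \<longrightarrow> b \<lhd> c \<longrightarrow> congruent a b a' b' \<longrightarrow> congruent b c b' c' \<longrightarrow> congruent a c a' c'"
    by blast
  show "\<forall>a\<in>S. \<forall>b\<in>S. \<forall>c\<in>S. \<forall>a'\<in>S. \<forall>b'\<in>S. \<forall>c'\<in>S.
      a \<lhd> b \<longrightarrow> b \<lhd> c \<longrightarrow> congruent a b b' a' \<longrightarrow> congruent b c c' b' \<longrightarrow> congruent a c c' a'"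
  proof (intro ballI impI)
    fix a b c a' b' c'
    assume S: "a \<in> S" "b \<in> S" "c \<in> S" "a' \<in> S" "b' \<in> S" "c' \<in> S"
      and congr: "congruent a b b' a'" "congruent b c c' b'"
    have "T c / T a = (T b / T a) * (T c / T b)" using S T_pos[of b] by simp
    also have "\<dots> = (T a' / T b') * (T b' / T c')" using congr S by (simp add: value_congr_iff)
    also have "\<dots> = T a' / T c'" using S T_pos[of b'] by simp
    finally show "congruent a c c' a'"
      using S by (simp add: value_congr_iff)
  qed
next
  show "\<forall>P Q. P \<union> Q = S \<longrightarrow> P \<inter> Q = {} \<longrightarrow> P \<noteq> {} \<longrightarrow> Q \<noteq> {} \<longrightarrow>
      (\<forall>q\<in>Q. \<forall>p\<in>P. \<not> q \<lhd> p) \<longrightarrow>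
      (\<exists>\<theta>\<in>S. (\<forall>s\<in>S. s \<lhd> \<theta> \<longrightarrow> s \<in> P) \<and>
        (\<forall>s\<in>S. \<theta> \<lhd> s \<longrightarrow> s \<in> Q))"
  proof (intro allI impI)
    fix P Q assume PQ: "P \<union> Q = S" "P \<inter> Q = {}" "P \<noteq> {}" "Q \<noteq> {}"
      "\<forall>q\<in>Q. \<forall>p\<in>P. \<not> q \<lhd> p"
    \<comment> \<open>The cut is located at the supremum of the values on its lower part.\<close>
    obtain p0 q0 where p0: "p0 \<in> P" and q0: "q0 \<in> Q" using PQ by blast
    have le: "T p \<le> T q" if "p \<in> P" "q \<in> Q" for p q
      using PQ(1,5) that by (force simp: value_lower_def)
    have bdd: "bdd_above (T ` P)" using le q0 by (intro bdd_aboveI[of _ "T q0"]) auto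
    have "0 < T p0" using T_pos p0 PQ(1) by blast
    also have "T p0 \<le> Sup (T ` P)" using p0 bdd by (intro cSup_upper) auto
    finally obtain \<theta> where \<theta>: "\<theta> \<in> S" "T \<theta> = Sup (T ` P)" using T_surj by blast
    have "s \<in> P" if "s \<lhd> \<theta>" for s
    proof -
      have "T s < Sup (T ` P)" "s \<in> S" using that \<theta> by (simp_all add: value_lower_def)
      then obtain p where "p \<in> P" "T s < T p"
        using less_cSup_iff[OF _ bdd, of "T s"] PQ(3) by auto
      then show ?thesis using le[of p s] \<open>s \<in> S\<close> PQ(1) by auto
    qed
    moreover have "s \<in> Q" if "\<theta> \<lhd> s" for s
    proof -
      have "Sup (T ` P) < T s" "s \<in> S" using that \<theta> by (simp_all add: value_lower_def)
      then have "s \<notin> P" using cSup_upper[OF _ bdd, of "T s"] by auto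
      then show ?thesis using \<open>s \<in> S\<close> PQ(1) by auto
    qed
    ultimately show "\<exists>\<theta>\<in>S. (\<forall>s\<in>S. s \<lhd> \<theta> \<longrightarrow> s \<in> P) \<and>
        (\<forall>s\<in>S. \<theta> \<lhd> s \<longrightarrow> s \<in> Q)"
      using \<theta>(1) by blast
  qed
qed

text \<open>Quotients of values form a measure, and the measure is unique.\<close>
lemma interval_measure_eq:
  assumes ref: "x0 \<in> S" "y0 \<in> S" "T y0 / T x0 = lam" and "lam > 1" and ab: "a \<in> S" "b \<in> S"
  shows "interval_measure S (value_lower S T) (value_congr S T) x0 y0 lam
      (interval S (value_lower S T) a b) = T b / T a"
proof -
  define m where "m = restrict (\<lambda>(A, B). class_value T B / class_value T A)
    (intervals S (value_lower S T))"
  have m: "m (interval S (value_lower S T) a b) = T b / T a" if "a \<in> S" "b \<in> S" for a b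
    using that by (auto simp: m_def interval_def intervals_def class_value pitches_eq)
  have "T x0 < T y0" using ref \<open>lam > 1\<close> T_pos[of x0] by auto
  then have less: "x0 \<lhd> y0" using ref by (simp add: value_lower_iff)
  have "is_measure S (value_lower S T) (value_congr S T) x0 y0 lam m"
    unfolding is_measure_def
  proof (intro conjI ballI)
    show "m \<in> intervals S (value_lower S T) \<rightarrow>\<^sub>E {0<..}"
      by (auto simp: m_def intervals_def class_value pitches_eq T_pos)
    show "m (interval S (value_lower S T) x0 y0) = lam" using ref by (simp add: m)
  next
    fix a b assume "a \<in> S" "b \<in> S"
    then show "m (interval S (value_lower S T) a b) > 1 \<longleftrightarrow> a \<lhd> b"
      and "m (interval S (value_lower S T) a b) = 1 \<longleftrightarrow> (a, b) \<in> same_pitch S (value_lower S T)"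
      and "m (interval S (value_lower S T) a b) < 1 \<longleftrightarrow> b \<lhd> a"
      using T_pos[of a] T_pos[of b] by (auto simp: m value_lower_iff value_same_pitch_iff)
  next
    fix a b c d assume "a \<in> S" "b \<in> S" "c \<in> S" "d \<in> S"
    then show "m (interval S (value_lower S T) a b) = m (interval S (value_lower S T) c d) \<longleftrightarrow>
        congruent a b c d"
      by (simp add: m value_congr_iff)
  next
    fix a b c assume "a \<in> S" "b \<in> S" "c \<in> S"
    then show "m (interval S (value_lower S T) a c) =
        m (interval S (value_lower S T) a b) * m (interval S (value_lower S T) b c)"
      using T_pos[of b] by (simp add: m)
  qed
  then have "interval_measure S (value_lower S T) (value_congr S T) x0 y0 lam = m"
    unfolding interval_measure_def
    using measure_exists_unique[OF ref(1,2) less \<open>lam > 1\<close>] by (intro the1_equality)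
  then show ?thesis using m ab by simp
qed

end

text \<open>Each function is its own timbre and its amplitude is its intensity; cosines provide
  every combination of period and amplitude.\<close>
theorem PI_model_Cp:
  assumes "lam > 1" "f0 > 0" "i0 > 0"
  shows "\<exists>x0 y0. PI_model lam f0 i0 Cp (value_lower Cp least_period) (value_congr Cp least_period) x0 y0"
proof -
  interpret frequency_coordinate Cp least_period
  proof
    have "T \<in> least_period ` Cp" if "T > 0" for T
      using Cp_cosine[OF that zero_less_one] by blast
    then show "least_period ` Cp = {0<..}" using Cp_least_period(1) by auto
  qed
  obtain x0 where x0: "x0 \<in> Cp" "least_period x0 = f0" "amplitude x0 = i0"
    using Cp_cosine assms by metis
  obtain y0 where y0: "y0 \<in> Cp" "least_period y0 = lam * f0"
    using T_surj[of "lam * f0"] assms by auto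
  have freq: "frequency Cp (value_lower Cp least_period) (value_congr Cp least_period) x0 y0 lam f0 x
      = least_period x" if "x \<in> Cp" for x
    unfolding frequency_def using interval_measure_eq[of x0 y0 lam x0 x] x0 y0 assms that by simp
  have "PI_model lam f0 i0 Cp (value_lower Cp least_period) (value_congr Cp least_period) x0 y0"
  proof unfold_locales
    show "lam > 1" "f0 > 0" "i0 > 0" "x0 \<in> Cp" "y0 \<in> Cp" by fact+
    show "(x0, y0) \<in> value_lower Cp least_period" using x0 y0 assms by (simp add: value_lower_iff)
    have "is_intensity Cp (value_lower Cp least_period) x0 i0 amplitude"
      unfolding is_intensity_def value_same_pitch_iff
    proof (intro conjI allI impI ballI)
      show "amplitude \<in> Cp \<rightarrow> {0<..}" using Cp_amplitude_pos by auto
      show "amplitude x0 = i0" by fact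
      show "\<exists>x\<in>Cp. (x \<in> Cp \<and> s \<in> Cp \<and> least_period x = least_period s) \<and> amplitude x = r"
        if "r > 0" "s \<in> Cp" for r s
        using Cp_cosine[OF Cp_least_period(1)[OF that(2)] that(1)] that by metis
    qed
    moreover have "is_timbre Cp
        (frequency Cp (value_lower Cp least_period) (value_congr Cp least_period) x0 y0 lam f0)
        amplitude (\<lambda>x. x)"
      by (simp add: is_timbre_def freq)
    ultimately show "\<exists>\<iota> \<Gamma>. is_intensity Cp (value_lower Cp least_period) x0 i0 \<iota> \<and>
        is_timbre Cp
          (frequency Cp (value_lower Cp least_period) (value_congr Cp least_period) x0 y0 lam f0) \<iota> \<Gamma> \<and>
        (\<forall>x\<in>Cp. \<forall>y\<in>Cp. \<Gamma> x = \<Gamma> y \<longrightarrow> x = y)"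
      by blast
  qed
  then show ?thesis by blast
qed

section \<open>Categoricity\<close>

theorem mainTheorem1:
  fixes lam f0 i0 :: real
  assumes "lam > 1" and "f0 > 0" and "i0 > 0"
  shows "(\<exists>(S :: (real \<Rightarrow> real) set) lower congr x0 y0.
            PI_model lam f0 i0 S lower congr x0 y0) \<and>
         (\<forall>(S1 :: 'a set) lower1 congr1 x1 y1 (S2 :: 'b set) lower2 congr2 x2 y2.
            PI_model lam f0 i0 S1 lower1 congr1 x1 y1 \<longrightarrow>
            PI_model lam f0 i0 S2 lower2 congr2 x2 y2 \<longrightarrow>
            (\<exists>h. is_isomorphism S1 lower1 congr1 S2 lower2 congr2 h))"
proof (intro conjI allI impI)
  show "\<exists>(S :: (real \<Rightarrow> real) set) lower congr x0 y0. PI_model lam f0 i0 S lower congr x0 y0"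
    using PI_model_Cp[OF assms] by blast
qed (rule PI_model_isomorphic)

end
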